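(* Let $E$ be a complex Banach lattice and let $(e^{tA})_{t\ge0}$ be a real, analytic, uniformly eventually positive, and persistently irreducible $C_0$-semigroup on $E$. If $(e^{tA})_{t\ge0}$ has relatively compact orbits, then exactly one of the following holds: (i) The semigroup $(e^{tA})_{t\ge0}$ converges strongly to $0$ as $t\to\infty$. (ii) The semigroup $(e^{tA})_{t\ge0}$ converges strongly as $t\to\infty$ to the rank-one projection $u\otimes\varphi$ for a quasi-interior point $u$ of $E_+$ and a strictly positive functional $\varphi\in E'$ such that $u\in\ker A$ and $\varphi\in\ker A'$.
   Context: $E_+$ is the positive cone; $0\lneq f$ means $f\ge0$ and $f\neq0$. A bounded operator on a complex Banach lattice is real if it maps the real part $E_{\mathbb R}$ into itself; a semigroup is real if each $e^{tA}$ is real. The semigroup is uniformly eventually positive if there is $t_0\ge0$ such that $e^{tA}f\ge0$ for all $t\ge t_0$ and all $0\le f\in E$. It has relatively compact orbits if $\{e^{tA}f:t\ge0\}$ is relatively (norm) compact for every $f\in E$. A (lattice) ideal of $E$ is a subspace $I$ such that $|y|\le|x|$, $x\in I$ implies $y\in I$. The semigroup is persistently irreducible if, whenever $I$ is a closed ideal of $E$ for which there exists $t_0\ge0$ with $e^{tA}I\subseteq I$ for all $t\ge t_0$, one has $I=\{0\}$ or $I=E$. An element $u\in E_+$ is a quasi-interior point of $E_+$ if the principal ideal $E_u=\{f\in E:|f|\le cu\text{ for some }c>0\}$ is dense in $E$. A positive functional $\varphi\in E'$ is strictly positive if $\langle\varphi,f\rangle>0$ for all $0\lneq f\in E$. $u\otimes\varphi$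 is the operator $f\mapsto\langle\varphi,f\rangle u$. *)

theory Defs
  imports "HOL-Analysis.Analysis" "HOL-Library.Lattice_Algebras"
begin

section \<open>Real Banach lattices\<close>

class banach_lattice = banach + ordered_real_vector + lattice_ab_group_add_abs +
  assumes norm_mono_abs: "\<bar>x\<bar> \<le> \<bar>y\<bar> \<Longrightarrow> norm x \<le> norm y"

instance real :: banach_lattice
  by standard simp

lemma norm_abs_lattice [simp]: "norm \<bar>x\<bar> = norm (x :: 'a :: banach_lattice)"
  by (intro antisym norm_mono_abs) simp_all

lemma norm_mono_nonneg: "0 \<le> x \<Longrightarrow> x \<le> y \<Longrightarrow> norm x \<le> norm (y :: 'a :: banach_lattice)"
  by (rule norm_mono_abs) (use order_trans[of 0 x y] in simp)

lemma LIMSEQ_nonneg_lattice: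
  fixes a :: "nat \<Rightarrow> 'a :: banach_lattice"
  assumes "a \<longlonglongrightarrow> l" and nn: "\<And>n. 0 \<le> a n"
  shows "0 \<le> l"
proof -
  let ?p = "sup (- l) 0"
  have "norm ?p \<le> norm (a n - l)" for n
  proof -
    have "- l \<le> a n - l" using nn[of n] by simp
    also have "\<dots> \<le> \<bar>a n - l\<bar>" by (rule abs_ge_self)
    finally have "?p \<le> \<bar>a n - l\<bar>" by simp
    then have "norm ?p \<le> norm \<bar>a n - l\<bar>" by (intro norm_mono_nonneg) simp_all
    then show ?thesis by simp
  qed
  moreover have "(\<lambda>n. norm (a n - l)) \<longlonglongrightarrow> 0"
    using assms(1) LIM_zero tendsto_norm_zero by blast
  ultimately have "norm ?p \<le> 0"
    by (meson LIMSEQ_le_const)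
  then have "?p = 0" by simp
  then have "- l \<le> 0" by (metis sup_ge1)
  then show ?thesis by simp
qed

lemma LIMSEQ_le_lattice:
  fixes a b :: "nat \<Rightarrow> 'a :: banach_lattice"
  assumes "a \<longlonglongrightarrow> l" "b \<longlonglongrightarrow> m" "\<And>n. a n \<le> b n"
  shows "l \<le> m"
  using LIMSEQ_nonneg_lattice[OF tendsto_diff[OF assms(2,1)]] assms(3) by simp

lemma abs_scaleR_le:
  fixes x :: "'a :: banach_lattice"
  shows "t *\<^sub>R x \<le> \<bar>t\<bar> *\<^sub>R \<bar>x\<bar>"
proof (cases "0 \<le> t")
  case True
  then show ?thesis using scaleR_left_mono[OF abs_ge_self[of x] True] by simp
next
  case False
  then have "(- t) *\<^sub>R (- x) \<le> (- t) *\<^sub>R \<bar>x\<bar>"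
    by (intro scaleR_left_mono) (auto simp: abs_ge_minus_self)
  then show ?thesis using False by simp
qed

section \<open>Complex Banach lattices\<close>

text \<open>
  A complex Banach lattice is the complexification \<open>E = E\<^sub>\<real> + \<i> E\<^sub>\<real>\<close> of a real Banach lattice \<open>E\<^sub>\<real>\<close>,
  with modulus \<open>\<bar>x + \<i> y\<bar> = sup\<^sub>\<theta> (cos \<theta> x + sin \<theta> y)\<close> and norm \<open>\<parallel>z\<parallel> = \<parallel> \<bar>z\<bar> \<parallel>\<close>.
\<close>

datatype 'a complexification = Complexification (re_part: 'a) (im_part: 'a)

definition is_modulus :: "'a :: banach_lattice \<Rightarrow> 'a \<Rightarrow> 'a \<Rightarrow> bool"
  where "is_modulus x y m \<longleftrightarrow>
    (\<forall>\<theta>::real. cos \<theta> *\<^sub>R x + sin \<theta> *\<^sub>R y \<le> m) \<and>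
    (\<forall>b. (\<forall>\<theta>::real. cos \<theta> *\<^sub>R x + sin \<theta> *\<^sub>R y \<le> b) \<longrightarrow> m \<le> b)"

definition modulus :: "'a :: banach_lattice complexification \<Rightarrow> 'a"
  where "modulus z = (THE m. is_modulus (re_part z) (im_part z) m)"

lemma is_modulus_exists: "\<exists>m. is_modulus x y (m :: 'a :: banach_lattice)"
proof -
  define S where "S = (\<lambda>\<theta>::real. cos \<theta> *\<^sub>R x + sin \<theta> *\<^sub>R y)"
  define w where "w = \<bar>x\<bar> + \<bar>y\<bar>"
  have w0: "0 \<le> w" by (simp add: w_def)
  have lip: "S s \<le> S t + \<bar>s - t\<bar> *\<^sub>R w" for s t
  proof -
    have c: "\<bar>cos s - cos t\<bar> \<le> \<bar>s - t\<bar>" and d: "\<bar>sin s - sin t\<bar> \<le> \<bar>s - t\<bar>"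
    proof -
      have *: "\<bar>sin ((s - t) / 2)\<bar> \<le> \<bar>s - t\<bar> / 2"
        using abs_sin_x_le_abs_x[of "(s - t) / 2"] by simp
      have **: "\<bar>sin ((t - s) / 2)\<bar> \<le> \<bar>s - t\<bar> / 2"
        using abs_sin_x_le_abs_x[of "(t - s) / 2"] by simp
      have "\<bar>cos s - cos t\<bar> = 2 * (\<bar>sin ((s + t) / 2)\<bar> * \<bar>sin ((t - s) / 2)\<bar>)"
        by (simp only: cos_diff_cos abs_mult)
      also have "\<dots> \<le> 2 * (1 * (\<bar>s - t\<bar> / 2))"
        by (intro mult_left_mono mult_mono ** abs_sin_le_one) simp_all
      finally show "\<bar>cos s - cos t\<bar> \<le> \<bar>s - t\<bar>" by simp
      have "\<bar>sin s - sin t\<bar> = 2 * (\<bar>sin ((s - t) / 2)\<bar> * \<bar>cos ((s + t) / 2)\<bar>)"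
        by (simp only: sin_diff_sin abs_mult)
      also have "\<dots> \<le> 2 * ((\<bar>s - t\<bar> / 2) * 1)"
        by (intro mult_left_mono mult_mono * abs_cos_le_one) simp_all
      finally show "\<bar>sin s - sin t\<bar> \<le> \<bar>s - t\<bar>" by simp
    qed
    have "S s - S t = (cos s - cos t) *\<^sub>R x + (sin s - sin t) *\<^sub>R y"
      by (simp add: S_def algebra_simps)
    also have "\<dots> \<le> \<bar>cos s - cos t\<bar> *\<^sub>R \<bar>x\<bar> + \<bar>sin s - sin t\<bar> *\<^sub>R \<bar>y\<bar>"
      by (intro add_mono abs_scaleR_le)
    also have "\<dots> \<le> \<bar>s - t\<bar> *\<^sub>R \<bar>x\<bar> + \<bar>s - t\<bar> *\<^sub>R \<bar>y\<bar>"
      by (intro add_mono scaleR_right_mono c d) simp_all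
    finally show ?thesis by (simp add: w_def algebra_simps)
  qed
  have "\<exists>K. finite K \<and> {0..2*pi} \<subseteq> (\<Union>k\<in>K. ball k (inverse (Suc n)))" for n
  proof -
    have "0 < inverse (real (Suc n))" by simp
    with compact_Icc[of 0 "2*pi"] show ?thesis
      unfolding compact_eq_totally_bounded by blast
  qed
  then obtain K where K: "\<And>n. finite (K n)"
      "\<And>n. {0..2*pi} \<subseteq> (\<Union>k\<in>K n. ball k (inverse (Suc n)))"
    by metis
  have Kne: "K n \<noteq> {}" for n
    using K(2)[of n] by fastforce
  define a where "a n = Sup_fin (S ` K n)" for n
  have Sa: "S k \<le> a n" if "k \<in> K n" for k n
    unfolding a_def using that K(1) by (intro Sup_fin.coboundedI) auto
  have aleast: "a n \<le> b" if "\<And>\<theta>. S \<theta> \<le> b" for b n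
    unfolding a_def using that K(1) Kne by (intro Sup_fin.boundedI) auto
  have ub: "S \<theta> \<le> a n + inverse (Suc n) *\<^sub>R w" for \<theta> n
  proof -
    obtain t where t: "0 \<le> t" "t \<le> 2 * pi" "cos \<theta> = cos t" "sin \<theta> = sin t"
      using sincos_total_2pi_le[of "cos \<theta>" "sin \<theta>"] by auto
    then obtain k where k: "k \<in> K n" "dist k t < inverse (Suc n)"
      using K(2)[of n] by fastforce
    have "S \<theta> = S t" using t by (simp add: S_def)
    also have "\<dots> \<le> S k + \<bar>t - k\<bar> *\<^sub>R w" by (rule lip)
    also have "\<dots> \<le> a n + inverse (Suc n) *\<^sub>R w"
      using k by (intro add_mono Sa scaleR_right_mono w0) (auto simp: dist_real_def)
    finally show ?thesis .
  qed
  have diff: "a m - a n \<le> inverse (Suc n) *\<^sub>R w" for m n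
    using aleast[OF ub] by (simp add: algebra_simps)
  have nrm: "norm (a m - a n) \<le> inverse (Suc N) * norm w" if "N \<le> m" "N \<le> n" for m n N
  proof -
    have 1: "inverse (Suc j) *\<^sub>R w \<le> inverse (Suc N) *\<^sub>R w" if "N \<le> j" for j
      using that by (intro scaleR_right_mono w0) (simp add: field_simps)
    have "\<bar>a m - a n\<bar> \<le> inverse (Suc N) *\<^sub>R w"
      using order_trans[OF diff[of m n] 1[OF that(2)]] order_trans[OF diff[of n m] 1[OF that(1)]]
      by (intro abs_leI) simp_all
    from norm_mono_nonneg[OF abs_ge_zero this] show ?thesis by simp
  qed
  have inv0: "(\<lambda>n. inverse (real (Suc n)) * norm w) \<longlonglongrightarrow> 0"
    using tendsto_mult_left_zero[OF LIMSEQ_inverse_real_of_nat] by simp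
  have "Cauchy a"
  proof (rule metric_CauchyI)
    fix e :: real assume "0 < e"
    with inv0 obtain N where "inverse (Suc N) * norm w < e"
      using order_tendstoD(2)[OF inv0 \<open>0 < e\<close>] by (auto simp: eventually_sequentially)
    then show "\<exists>M. \<forall>m\<ge>M. \<forall>n\<ge>M. dist (a m) (a n) < e"
      using nrm unfolding dist_norm by (meson le_less_trans)
  qed
  then obtain l where l: "a \<longlonglongrightarrow> l"
    using Cauchy_convergent_iff convergent_def by blast
  have "(\<lambda>n. a n + inverse (real (Suc n)) *\<^sub>R w) \<longlonglongrightarrow> l + 0 *\<^sub>R w"
    by (intro tendsto_intros l LIMSEQ_inverse_real_of_nat)
  then have "S \<theta> \<le> l" for \<theta>
    using LIMSEQ_le_lattice[OF tendsto_const _ ub[of \<theta>]] by simp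
  moreover have "l \<le> b" if "\<And>\<theta>. S \<theta> \<le> b" for b
    using LIMSEQ_le_lattice[OF l tendsto_const aleast[OF that]] .
  ultimately show ?thesis unfolding is_modulus_def S_def by blast
qed

lemma is_modulus_modulus: "is_modulus (re_part z) (im_part z) (modulus z)"
proof -
  obtain m where m: "is_modulus (re_part z) (im_part z) m"
    using is_modulus_exists by blast
  have "m' = m" if "is_modulus (re_part z) (im_part z) m'" for m'
    using m that unfolding is_modulus_def by (meson order_antisym)
  then show ?thesis unfolding modulus_def
    using theI[where P = "is_modulus (re_part z) (im_part z)", OF m] by blast
qed

lemma modulus_upper: "cos \<theta> *\<^sub>R re_part z + sin \<theta> *\<^sub>R im_part z \<le> modulus z"
  using is_modulus_modulus[of z] unfolding is_modulus_def by blast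

lemma modulus_least:
  "(\<And>\<theta>. cos \<theta> *\<^sub>R re_part z + sin \<theta> *\<^sub>R im_part z \<le> b) \<Longrightarrow> modulus z \<le> b"
  using is_modulus_modulus[of z] unfolding is_modulus_def by blast

lemma abs_re_le_modulus: "\<bar>re_part z\<bar> \<le> modulus z"
  using modulus_upper[of 0 z] modulus_upper[of pi z] by (intro abs_leI) simp_all

lemma abs_im_le_modulus: "\<bar>im_part z\<bar> \<le> modulus z"
  using modulus_upper[of "pi/2" z] modulus_upper[of "- (pi/2)" z] by (intro abs_leI) simp_all

lemma modulus_nonneg: "0 \<le> modulus z"
  using order_trans[OF abs_ge_zero abs_re_le_modulus] .

lemma modulus_le: "modulus z \<le> \<bar>re_part z\<bar> + \<bar>im_part z\<bar>"
proof (rule modulus_least)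
  fix \<theta> :: real
  have "cos \<theta> *\<^sub>R re_part z + sin \<theta> *\<^sub>R im_part z
      \<le> \<bar>cos \<theta>\<bar> *\<^sub>R \<bar>re_part z\<bar> + \<bar>sin \<theta>\<bar> *\<^sub>R \<bar>im_part z\<bar>"
    by (intro add_mono abs_scaleR_le)
  also have "\<dots> \<le> 1 *\<^sub>R \<bar>re_part z\<bar> + 1 *\<^sub>R \<bar>im_part z\<bar>"
    by (intro add_mono scaleR_right_mono) simp_all
  finally show "cos \<theta> *\<^sub>R re_part z + sin \<theta> *\<^sub>R im_part z \<le> \<bar>re_part z\<bar> + \<bar>im_part z\<bar>"
    by simp
qed

subsection \<open>Vector space structure, order and norm\<close>

instantiation complexification :: (banach_lattice) real_vector
begin
definition "0 = Complexification 0 0"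
definition "z + w = Complexification (re_part z + re_part w) (im_part z + im_part w)"
definition "- z = Complexification (- re_part z) (- im_part z)"
definition "z - w = Complexification (re_part z - re_part w) (im_part z - im_part w)"
definition "r *\<^sub>R z = Complexification (r *\<^sub>R re_part z) (r *\<^sub>R im_part z)"
instance
  by standard
    (simp_all add: zero_complexification_def plus_complexification_def uminus_complexification_def
      minus_complexification_def scaleR_complexification_def algebra_simps)
end

lemma complexification_parts [simp]:
  "re_part 0 = (0 :: 'a :: banach_lattice)" "im_part 0 = (0 :: 'a)"
  "re_part (z + w) = re_part z + (re_part w :: 'a)" "im_part (z + w) = im_part z + (im_part w :: 'a)"
  "re_part (- z) = - (re_part z :: 'a)" "im_part (- z) = - (im_part z :: 'a)"
  "re_part (z - w) = re_part z - (re_part w :: 'a)" "im_part (z - w) = im_part z - (im_part w :: 'a)"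
  "re_part (r *\<^sub>R z) = r *\<^sub>R (re_part z :: 'a)" "im_part (r *\<^sub>R z) = r *\<^sub>R (im_part z :: 'a)"
  by (simp_all add: zero_complexification_def plus_complexification_def uminus_complexification_def
      minus_complexification_def scaleR_complexification_def)

lemma complexification_eq_iff: "z = w \<longleftrightarrow> re_part z = re_part w \<and> im_part z = im_part w"
  by (cases z; cases w) simp

definition scaleC :: "complex \<Rightarrow> 'a :: banach_lattice complexification \<Rightarrow> 'a complexification"
    (infixr "*\<^sub>C" 75)
  where "c *\<^sub>C z = Complexification
    (Re c *\<^sub>R re_part z - Im c *\<^sub>R im_part z) (Re c *\<^sub>R im_part z + Im c *\<^sub>R re_part z)"

definition of_real_part :: "'a :: banach_lattice \<Rightarrow> 'a complexification"
  where "of_real_part x = Complexification x 0"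

instantiation complexification :: (banach_lattice) abs
begin
definition "\<bar>z\<bar> = of_real_part (modulus z)"
instance ..
end

text \<open>
  The order on \<open>E\<close> is the one induced by the cone \<open>E\<^sub>+\<close>; so \<open>0 \<le> f\<close> forces \<open>f\<close> to be real, and
  \<open>0 < f\<close> means \<open>0 \<le> f\<close> and \<open>f \<noteq> 0\<close>. The same convention is used for complex numbers in
  \<open>HOL-Library.Complex_Order\<close>.
\<close>

instantiation complexification :: (banach_lattice) ordered_real_vector
begin
definition "z \<le> w \<longleftrightarrow> re_part z \<le> re_part w \<and> im_part z = im_part w"
definition "(z :: 'a complexification) < w \<longleftrightarrow> z \<le> w \<and> \<not> w \<le> z"
instance
  by standard
    (auto simp: less_eq_complexification_def less_complexification_def complexification_eq_iff
      intro: scaleR_left_mono scaleR_right_mono)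
end

instantiation complexification :: (banach_lattice) real_normed_vector
begin
definition "norm z = norm (modulus z)"
definition "sgn z = inverse (norm z) *\<^sub>R (z :: 'a complexification)"
definition "dist z w = norm (z - w :: 'a complexification)"
definition "uniformity = (INF e\<in>{0<..}. principal {(z, w). dist (z :: 'a complexification) w < e})"
definition "open U \<longleftrightarrow>
  (\<forall>z\<in>U. eventually (\<lambda>(z', w). z' = z \<longrightarrow> w \<in> U) (uniformity :: ('a complexification \<times> _) filter))"
instance
proof
  fix z w :: "'a complexification" and r :: real
  have z0: "norm z = 0" if "z = 0"
  proof -
    have "modulus z \<le> 0" using modulus_le[of z] that by simp
    then show ?thesis using modulus_nonneg[of z]
      by (simp add: norm_complexification_def antisym)
  qed
  show "norm z = 0 \<longleftrightarrow> z = 0"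
    using abs_re_le_modulus[of z] abs_im_le_modulus[of z] z0
    by (auto simp: norm_complexification_def complexification_eq_iff)
  have "modulus (z + w) \<le> modulus z + modulus w"
  proof (rule modulus_least)
    fix \<theta>
    show "cos \<theta> *\<^sub>R re_part (z + w) + sin \<theta> *\<^sub>R im_part (z + w) \<le> modulus z + modulus w"
      using add_mono[OF modulus_upper[of \<theta> z] modulus_upper[of \<theta> w]] by (simp add: algebra_simps)
  qed
  then have "norm (modulus (z + w)) \<le> norm (modulus z + modulus w)"
    by (intro norm_mono_nonneg modulus_nonneg)
  then show "norm (z + w) \<le> norm z + norm w"
    unfolding norm_complexification_def using norm_triangle_ineq order_trans by blast
  have le: "modulus (s *\<^sub>R v) \<le> \<bar>s\<bar> *\<^sub>R modulus v" for s and v :: "'a complexification"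
  proof (rule modulus_least)
    fix \<theta> :: real
    show "cos \<theta> *\<^sub>R re_part (s *\<^sub>R v) + sin \<theta> *\<^sub>R im_part (s *\<^sub>R v) \<le> \<bar>s\<bar> *\<^sub>R modulus v"
    proof (cases "0 \<le> s")
      case True
      then show ?thesis using scaleR_left_mono[OF modulus_upper[of \<theta> v] True]
        by (simp add: algebra_simps)
    next
      case False
      then show ?thesis using scaleR_left_mono[OF modulus_upper[of "\<theta> + pi" v], of "- s"]
        by (simp add: algebra_simps)
    qed
  qed
  have le': "norm (s *\<^sub>R v) \<le> \<bar>s\<bar> * norm v" for s and v :: "'a complexification"
    using norm_mono_nonneg[OF modulus_nonneg le[of s v]] by (simp add: norm_complexification_def)
  show "norm (r *\<^sub>R z) = \<bar>r\<bar> * norm z"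
  proof (cases "r = 0")
    case True
    then show ?thesis using z0 le'[of r z] by (simp add: norm_complexification_def)
  next
    case False
    have "norm z = norm (inverse r *\<^sub>R (r *\<^sub>R z))" using False by simp
    also have "\<dots> \<le> \<bar>inverse r\<bar> * norm (r *\<^sub>R z)" by (rule le')
    finally have "\<bar>r\<bar> * norm z \<le> norm (r *\<^sub>R z)" using False by (simp add: field_simps)
    then show ?thesis using le'[of r z] by simp
  qed
qed (simp_all only: sgn_complexification_def dist_complexification_def
      uniformity_complexification_def open_complexification_def)
end

lemma norm_re_part_le: "norm (re_part z) \<le> norm z"
  using norm_mono_nonneg[OF abs_ge_zero abs_re_le_modulus[of z]] by (simp add: norm_complexification_def)

lemma norm_im_part_le: "norm (im_part z) \<le> norm z"
  using norm_mono_nonneg[OF abs_ge_zero abs_im_le_modulus[of z]] by (simp add: norm_complexification_def)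

lemma norm_complexification_le: "norm z \<le> norm (re_part z) + norm (im_part z)"
  using norm_mono_nonneg[OF modulus_nonneg modulus_le[of z]]
    norm_triangle_ineq[of "\<bar>re_part z\<bar>" "\<bar>im_part z\<bar>"]
  by (simp add: norm_complexification_def)

instance complexification :: (banach_lattice) banach
proof
  fix X :: "nat \<Rightarrow> 'a complexification"
  assume X: "Cauchy X"
  have "Cauchy (\<lambda>n. re_part (X n))"
  proof (rule metric_CauchyI)
    fix e :: real assume "0 < e"
    then obtain M where "\<forall>m\<ge>M. \<forall>n\<ge>M. norm (X m - X n) < e"
      using metric_CauchyD[OF X] unfolding dist_norm by blast
    then show "\<exists>M. \<forall>m\<ge>M. \<forall>n\<ge>M. dist (re_part (X m)) (re_part (X n)) < e"
      using le_less_trans[OF norm_re_part_le] unfolding dist_norm by (metis complexification_parts(7))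
  qed
  then obtain x where x: "(\<lambda>n. re_part (X n)) \<longlonglongrightarrow> x"
    using Cauchy_convergent_iff convergent_def by blast
  have "Cauchy (\<lambda>n. im_part (X n))"
  proof (rule metric_CauchyI)
    fix e :: real assume "0 < e"
    then obtain M where "\<forall>m\<ge>M. \<forall>n\<ge>M. norm (X m - X n) < e"
      using metric_CauchyD[OF X] unfolding dist_norm by blast
    then show "\<exists>M. \<forall>m\<ge>M. \<forall>n\<ge>M. dist (im_part (X m)) (im_part (X n)) < e"
      using le_less_trans[OF norm_im_part_le] unfolding dist_norm by (metis complexification_parts(8))
  qed
  then obtain y where y: "(\<lambda>n. im_part (X n)) \<longlonglongrightarrow> y"
    using Cauchy_convergent_iff convergent_def by blast
  have lim: "(\<lambda>n. norm (re_part (X n) - x) + norm (im_part (X n) - y)) \<longlonglongrightarrow> 0"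
    using tendsto_add[OF tendsto_norm_zero[OF LIM_zero[OF x]] tendsto_norm_zero[OF LIM_zero[OF y]]]
    by simp
  have "(\<lambda>n. X n - Complexification x y) \<longlonglongrightarrow> 0"
    using norm_complexification_le[of "X _ - Complexification x y"]
    by (intro Lim_null_comparison[OF _ lim]) simp
  then show "convergent X"
    unfolding convergent_def using LIM_zero_cancel by blast
qed

lemma modulus_of_real_part [simp]: "modulus (of_real_part x) = \<bar>x\<bar>"
  using modulus_le[of "of_real_part x"] abs_re_le_modulus[of "of_real_part x"]
  by (simp add: of_real_part_def)

lemma scaleC_of_real: "of_real r *\<^sub>C z = r *\<^sub>R z"
  by (simp add: scaleC_def complexification_eq_iff)

lemma scaleC_scaleC: "c *\<^sub>C d *\<^sub>C z = (c * d) *\<^sub>C z"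
  by (simp add: scaleC_def algebra_simps)

lemma norm_scaleC [simp]: "norm (c *\<^sub>C z) = cmod c * norm z"
proof -
  have le: "norm (d *\<^sub>C v) \<le> cmod d * norm v" for d and v :: "'a complexification"
  proof -
    have "modulus (d *\<^sub>C v) \<le> cmod d *\<^sub>R modulus v"
    proof (rule modulus_least)
      fix \<theta> :: real
      have d: "Re d = cmod d * cos (Arg d)" "Im d = cmod d * sin (Arg d)"
        by (metis rcis_cmod_Arg Re_rcis) (metis rcis_cmod_Arg Im_rcis)
      have "cos \<theta> *\<^sub>R re_part (d *\<^sub>C v) + sin \<theta> *\<^sub>R im_part (d *\<^sub>C v) =
        cmod d *\<^sub>R (cos (\<theta> - Arg d) *\<^sub>R re_part v + sin (\<theta> - Arg d) *\<^sub>R im_part v)"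
        by (simp add: scaleC_def d cos_diff sin_diff algebra_simps)
      also have "\<dots> \<le> cmod d *\<^sub>R modulus v"
        by (intro scaleR_left_mono modulus_upper) simp
      finally show "cos \<theta> *\<^sub>R re_part (d *\<^sub>C v) + sin \<theta> *\<^sub>R im_part (d *\<^sub>C v) \<le> \<dots>" .
    qed
    from norm_mono_nonneg[OF modulus_nonneg this] show ?thesis
      by (simp add: norm_complexification_def)
  qed
  show ?thesis
  proof (cases "c = 0")
    case True
    then show ?thesis using le[of 0 z] by simp
  next
    case False
    then have "z = inverse c *\<^sub>C c *\<^sub>C z"
      using scaleC_of_real[of 1 z] by (simp add: scaleC_scaleC)
    then have "norm z \<le> cmod (inverse c) * norm (c *\<^sub>C z)" by (metis le)
    then have "norm z \<le> inverse (cmod c) * norm (c *\<^sub>C z)"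
      by (simp only: norm_inverse)
    then have "cmod c * norm z \<le> norm (c *\<^sub>C z)"
      using False by (simp add: field_simps)
    then show ?thesis using le[of c z] by simp
  qed
qed

section \<open>Operators, functionals, ideals\<close>

text \<open>The operator norm of such an \<open>B\<close> is \<open>onorm B\<close>.\<close>

definition bounded_operator :: "('a :: banach_lattice complexification \<Rightarrow> 'a complexification) \<Rightarrow> bool"
  where "bounded_operator B \<longleftrightarrow> bounded_linear B \<and> (\<forall>c f. B (c *\<^sub>C f) = c *\<^sub>C B f)"

definition dual_space :: "('a :: banach_lattice complexification \<Rightarrow> complex) set"
  where "dual_space = {\<phi>. bounded_linear \<phi> \<and> (\<forall>c f. \<phi> (c *\<^sub>C f) = c * \<phi> f)}"

definition strictly_positive :: "('a :: banach_lattice complexification \<Rightarrow> complex) \<Rightarrow> bool"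
  where "strictly_positive \<phi> \<longleftrightarrow> (\<forall>f. 0 \<le> f \<longrightarrow> 0 \<le> \<phi> f) \<and> (\<forall>f. 0 \<le> f \<and> f \<noteq> 0 \<longrightarrow> 0 < \<phi> f)"

definition real_part_space :: "'a :: banach_lattice complexification set"
  where "real_part_space = range of_real_part"

definition real_operator :: "('a :: banach_lattice complexification \<Rightarrow> 'a complexification) \<Rightarrow> bool"
  where "real_operator B \<longleftrightarrow> B ` real_part_space \<subseteq> real_part_space"

definition csubspace :: "'a :: banach_lattice complexification set \<Rightarrow> bool"
  where "csubspace I \<longleftrightarrow> 0 \<in> I \<and> (\<forall>x\<in>I. \<forall>y\<in>I. x + y \<in> I) \<and> (\<forall>c. \<forall>x\<in>I. c *\<^sub>C x \<in> I)"

definition lattice_ideal :: "'a :: banach_lattice complexification set \<Rightarrow> bool"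
  where "lattice_ideal I \<longleftrightarrow> csubspace I \<and> (\<forall>x y. \<bar>y\<bar> \<le> \<bar>x\<bar> \<and> x \<in> I \<longrightarrow> y \<in> I)"

definition principal_ideal :: "'a :: banach_lattice complexification \<Rightarrow> 'a complexification set"
  where "principal_ideal u = {f. \<exists>c>0. \<bar>f\<bar> \<le> c *\<^sub>R u}"

definition quasi_interior_point :: "'a :: banach_lattice complexification \<Rightarrow> bool"
  where "quasi_interior_point u \<longleftrightarrow> 0 \<le> u \<and> closure (principal_ideal u) = UNIV"

definition rank_one_op :: "'a :: banach_lattice complexification \<Rightarrow> ('a complexification \<Rightarrow> complex)
    \<Rightarrow> 'a complexification \<Rightarrow> 'a complexification"  (infix "\<otimes>\<^sub>o" 70)
  where "u \<otimes>\<^sub>o \<phi> = (\<lambda>f. \<phi> f *\<^sub>C u)"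

text \<open>On \<open>E = {0}\<close> the operator \<open>u \<otimes>\<^sub>o \<phi> = 0\<close> has rank zero, hence is not a rank-one projection.\<close>

definition rank_one_projection ::
    "('a :: banach_lattice complexification \<Rightarrow> 'a complexification) \<Rightarrow> bool"
  where "rank_one_projection P \<longleftrightarrow>
    bounded_operator P \<and> P \<circ> P = P \<and> (\<exists>v. v \<noteq> 0 \<and> range P = range (\<lambda>c. c *\<^sub>C v))"

section \<open>Semigroups\<close>

text \<open>
  A semigroup is a function on all of \<^typ>\<open>real\<close>, of which only the values at \<open>t \<ge> 0\<close> matter.
\<close>

definition C0_semigroup ::
    "(real \<Rightarrow> 'a :: banach_lattice complexification \<Rightarrow> 'a complexification) \<Rightarrow> bool"
  where "C0_semigroup T \<longleftrightarrow>
    (\<forall>t\<ge>0. bounded_operator (T t)) \<and> T 0 = id \<and>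
    (\<forall>s\<ge>0. \<forall>t\<ge>0. T (s + t) = T s \<circ> T t) \<and>
    (\<forall>f. ((\<lambda>t. T t f) \<longlongrightarrow> f) (at_right 0))"

text \<open>
  Unbounded operators are given by their graphs: \<open>(f, g) \<in> A\<close> means that \<open>f\<close> is in the domain of
  \<open>A\<close> and \<open>A f = g\<close>. In particular \<open>f \<in> ker A\<close> means \<open>(f, 0) \<in> A\<close>.
\<close>

definition generator ::
    "(real \<Rightarrow> 'a :: banach_lattice complexification \<Rightarrow> 'a complexification)
      \<Rightarrow> ('a complexification \<times> 'a complexification) set"
  where "generator T = {(f, g). ((\<lambda>h. inverse h *\<^sub>R (T h f - f)) \<longlongrightarrow> g) (at_right 0)}"

definition dual_operator ::
    "('a :: banach_lattice complexification \<times> 'a complexification) set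
      \<Rightarrow> (('a complexification \<Rightarrow> complex) \<times> ('a complexification \<Rightarrow> complex)) set"
  where "dual_operator A = {(\<phi>, \<psi>). \<phi> \<in> dual_space \<and> \<psi> \<in> dual_space \<and> (\<forall>(f, g)\<in>A. \<phi> g = \<psi> f)}"

definition sector :: "real \<Rightarrow> complex set"
  where "sector \<delta> = {z. z \<noteq> 0 \<and> \<bar>Arg z\<bar> < \<delta>}"

definition operator_analytic_on ::
    "(complex \<Rightarrow> 'a :: banach_lattice complexification \<Rightarrow> 'a complexification) \<Rightarrow> complex set \<Rightarrow> bool"
  where "operator_analytic_on S U \<longleftrightarrow> (\<forall>z\<in>U. \<exists>D. bounded_operator D \<and>
    ((\<lambda>w. onorm (\<lambda>f. inverse (w - z) *\<^sub>C (S w f - S z f) - D f)) \<longlongrightarrow> 0) (at z))"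

text \<open>
  Analyticity of a \<open>C\<^sub>0\<close>-semigroup: it extends analytically to an open sector, with the semigroup law
  and with strong continuity at \<open>0\<close> on every smaller sector. No boundedness on the whole sector is
  required.
\<close>

definition analytic_semigroup ::
    "(real \<Rightarrow> 'a :: banach_lattice complexification \<Rightarrow> 'a complexification) \<Rightarrow> bool"
  where "analytic_semigroup T \<longleftrightarrow>
    (\<exists>\<delta> S. 0 < \<delta> \<and> \<delta> \<le> pi / 2 \<and>
      (\<forall>t\<ge>0. S (complex_of_real t) = T t) \<and>
      (\<forall>z\<in>sector \<delta>. bounded_operator (S z)) \<and>
      (\<forall>z\<in>sector \<delta>. \<forall>w\<in>sector \<delta>. S (z + w) = S z \<circ> S w) \<and>
      operator_analytic_on S (sector \<delta>) \<and>
      (\<forall>\<delta>' f. 0 < \<delta>' \<and> \<delta>' < \<delta> \<longrightarrow> ((\<lambda>z. S z f) \<longlongrightarrow> f) (at 0 within sector \<delta>')))"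

definition real_semigroup ::
    "(real \<Rightarrow> 'a :: banach_lattice complexification \<Rightarrow> 'a complexification) \<Rightarrow> bool"
  where "real_semigroup T \<longleftrightarrow> (\<forall>t\<ge>0. real_operator (T t))"

definition uniformly_eventually_positive ::
    "(real \<Rightarrow> 'a :: banach_lattice complexification \<Rightarrow> 'a complexification) \<Rightarrow> bool"
  where "uniformly_eventually_positive T \<longleftrightarrow> (\<exists>t0\<ge>0. \<forall>t\<ge>t0. \<forall>f\<ge>0. 0 \<le> T t f)"

definition persistently_irreducible ::
    "(real \<Rightarrow> 'a :: banach_lattice complexification \<Rightarrow> 'a complexification) \<Rightarrow> bool"
  where "persistently_irreducible T \<longleftrightarrow>
    (\<forall>I. lattice_ideal I \<and> closed I \<and> (\<exists>t0\<ge>0. \<forall>t\<ge>t0. T t ` I \<subseteq> I) \<longrightarrow> I = {0} \<or> I = UNIV)"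

definition relatively_compact_orbits ::
    "(real \<Rightarrow> 'a :: banach_lattice complexification \<Rightarrow> 'a complexification) \<Rightarrow> bool"
  where "relatively_compact_orbits T \<longleftrightarrow> (\<forall>f. compact (closure ((\<lambda>t. T t f) ` {0..})))"

definition converges_strongly ::
    "(real \<Rightarrow> 'a :: banach_lattice complexification \<Rightarrow> 'a complexification)
      \<Rightarrow> ('a complexification \<Rightarrow> 'a complexification) \<Rightarrow> bool"
  where "converges_strongly T P \<longleftrightarrow> (\<forall>f. ((\<lambda>t. T t f) \<longlongrightarrow> P f) at_top)"

end

theory Submission
  imports Defs
begin

text \<open>
  Restrict the semigroup to the real part of \<open>E\<close> and call a vector recurrent if its orbit returns
  arbitrarily close to it at arbitrarily late times. Compactness of the orbits makes every vector the
  sum of a recurrent vector and one whose orbit tends to \<open>0\<close>, and on recurrent vectors the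
  semigroup acts by invertible operators whose inverses are positive and uniformly bounded.

  Suppose that the semigroup does not converge strongly to \<open>0\<close>. The vectors \<open>f\<close> for which the orbit
  of \<open>\<bar>f\<bar>\<close> tends to \<open>0\<close> form a closed ideal, which is \<open>{0}\<close> by irreducibility; hence the recurrent
  vectors are a sublattice. By analyticity the semigroup is uniformly continuous on it, and a
  uniformly continuous group of lattice isomorphisms preserves disjointness: if \<open>h\<close> and \<open>k\<close> are
  disjoint, so are \<open>S t h\<close> and \<open>k\<close>. By irreducibility one of them then vanishes. The recurrent
  vectors are therefore totally ordered, so they form a line spanned by a positive fixed vector.
\<close>

section \<open>Banach lattices and uniform boundedness\<close>

text \<open>The rotation semigroup on the circle is positive and irreducible, has relatively compact
  orbits and does not converge. Continuity in operator norm is what excludes it, since a small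
  rotation moves a function of small support to a disjoint one. The hypotheses supply norm
  continuity only at positive times and positivity only from \<open>t0\<close> on. Both defects
  disappear on recurrent vectors, for one reason: such a vector is approximately its own image at
  arbitrarily late times. A sign acquired late is thus inherited by the vector itself, and every
  recurrent \<open>x\<close> has the form \<open>S 1 h\<close> with \<open>h\<close> at most
  \<open>M\<close> times as large, which carries norm continuity from time 1 back to time 0.
  Elsewhere the restriction to late times remains:
  \<open>\<bar>S t x\<bar> \<le> S t \<bar>x\<bar>\<close> is available only for
  \<open>t \<ge> t0\<close>, so the ideals built from absolute values are invariant only from
  \<open>t0\<close> on. Persistent irreducibility covers exactly such ideals.\<close>

lemma abs_scaleR_le_abs: "\<bar>c *\<^sub>R x\<bar> \<le> \<bar>c\<bar> *\<^sub>R \<bar>x :: 'a :: banach_lattice\<bar>"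
proof (rule abs_leI)
  show "- (c *\<^sub>R x) \<le> \<bar>c\<bar> *\<^sub>R \<bar>x\<bar>" using abs_scaleR_le[of "- c" x] by simp
qed (rule abs_scaleR_le)

section \<open>Continuity of the lattice operations\<close>

lemma norm_abs_diff_le: "norm (\<bar>x\<bar> - \<bar>y\<bar>) \<le> norm (x - y :: 'a :: banach_lattice)"
  by (intro norm_mono_abs abs_triangle_ineq3)

lemma tendsto_abs_lattice:
  fixes f :: "'b \<Rightarrow> 'a :: banach_lattice"
  assumes "(f \<longlongrightarrow> l) F"
  shows "((\<lambda>x. \<bar>f x\<bar>) \<longlongrightarrow> \<bar>l\<bar>) F"
proof -
  have "((\<lambda>x. \<bar>f x\<bar> - \<bar>l\<bar>) \<longlongrightarrow> 0) F"
    by (rule Lim_null_comparison[OF always_eventually tendsto_norm_zero[OF LIM_zero[OF assms]]])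
      (simp add: norm_abs_diff_le)
  then show ?thesis by (rule LIM_zero_cancel)
qed

text \<open>Translations commute with \<open>inf\<close>, so enlarging both arguments by
  \<open>\<bar>x - y\<bar>\<close> enlarges the infimum by exactly that.\<close>

lemma norm_inf_diff_le: "norm (inf x k - inf y k) \<le> norm (x - y :: 'a :: banach_lattice)"
proof -
  have *: "inf a k - inf b k \<le> \<bar>a - b\<bar>" for a b :: 'a
  proof -
    have "a \<le> b + \<bar>a - b\<bar>" using abs_ge_self[of "a - b"] by (simp add: algebra_simps)
    moreover have "k \<le> k + \<bar>a - b\<bar>" by simp
    ultimately have "inf a k \<le> inf (b + \<bar>a - b\<bar>) (k + \<bar>a - b\<bar>)" by (rule inf_mono)
    also have "\<dots> = inf b k + \<bar>a - b\<bar>" by (rule add_inf_distrib_right[symmetric])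
    finally show ?thesis by (metis diff_le_eq add.commute)
  qed
  show ?thesis
    using *[of x y] *[of y x] unfolding abs_minus_commute[of y x]
    by (intro norm_mono_abs abs_leI) (simp_all only: minus_diff_eq)
qed

lemma tendsto_inf_lattice:
  fixes f :: "'b \<Rightarrow> 'a :: banach_lattice"
  assumes "(f \<longlongrightarrow> l) F"
  shows "((\<lambda>x. inf (f x) k) \<longlongrightarrow> inf l k) F"
proof -
  have "((\<lambda>x. inf (f x) k - inf l k) \<longlongrightarrow> 0) F"
    by (rule Lim_null_comparison[OF always_eventually tendsto_norm_zero[OF LIM_zero[OF assms]]])
      (intro allI norm_inf_diff_le)
  then show ?thesis by (rule LIM_zero_cancel)
qed

text \<open>Subtracting \<open>inf a k\<close> from the left side leaves a vector below both
  \<open>b\<close> and \<open>k\<close>. This is how disjointness from \<open>k\<close> passes to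
  sums.\<close>

lemma inf_add_le:
  fixes a b k :: "'a :: banach_lattice"
  assumes "0 \<le> a" "0 \<le> b" "0 \<le> k"
  shows "inf (a + b) k \<le> inf a k + inf b k"
proof -
  let ?w = "inf (a + b) k"
  have "?w - inf a k \<le> b"
  proof -
    have "?w \<le> inf (a + b) (k + b)" using assms by (simp add: le_infI2 add_increasing2)
    also have "\<dots> = inf a k + b" by (rule add_inf_distrib_right[symmetric])
    finally show ?thesis by (metis diff_le_eq add.commute)
  qed
  moreover have "?w - inf a k \<le> k"
    using assms by (meson diff_le_eq inf_le2 le_inf_iff order_trans add_increasing2)
  ultimately have "?w - inf a k \<le> inf b k" by simp
  then show ?thesis by (metis diff_le_eq add.commute)
qed

text \<open>By Baire some \<open>C n\<close> contains a ball around a point \<open>a\<close>. Every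
  vector is a scaled difference of two points of that ball, whence the factor
  \<open>2 * real n / r\<close>; the maximum with 1 keeps \<open>M\<close> invertible.\<close>

lemma uniform_boundedness:
  fixes S :: "'i \<Rightarrow> 'a :: banach \<Rightarrow> 'b :: real_normed_vector"
  assumes lin: "\<And>i. i \<in> I \<Longrightarrow> bounded_linear (S i)"
    and bnd: "\<And>x. \<exists>B. \<forall>i\<in>I. norm (S i x) \<le> B"
  obtains M where "1 \<le> M" "\<And>i x. i \<in> I \<Longrightarrow> norm (S i x) \<le> M * norm x"
proof -
  define C where "C n = (\<Inter>i\<in>I. {x. norm (S i x) \<le> real n})" for n
  have clo: "closed (C n)" for n
    unfolding C_def
    by (intro closed_INT ballI closed_Collect_le continuous_intros
        linear_continuous_on lin)
  have "(\<Union>n. C n) = UNIV"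
  proof (intro set_eqI iffI UNIV_I)
    fix x
    obtain B where B: "\<forall>i\<in>I. norm (S i x) \<le> B" using bnd by blast
    obtain n where "B \<le> real n" using real_arch_simple by blast
    with B have "x \<in> C n" unfolding C_def by (auto intro: order_trans)
    then show "x \<in> (\<Union>n. C n)" by blast
  qed
  have "\<exists>n. interior (C n) \<noteq> {}"
  proof (rule ccontr)
    assume "\<not> ?thesis"
    then have "euclidean interior_of \<Union>(range C) = {}"
      using clo by (intro Baire_category_alt) (auto simp: completely_metrizable_space_euclidean)
    with \<open>(\<Union>n. C n) = UNIV\<close> show False by simp
  qed
  then obtain n a where "a \<in> interior (C n)" by auto
  then obtain r where r: "0 < r" "cball a r \<subseteq> C n"
    by (meson mem_interior_cball)
  define M where "M = max 1 (2 * real n / r)"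
  show thesis
  proof (rule that[of M])
    show "1 \<le> M" by (simp add: M_def)
    fix i x assume i: "i \<in> I"
    interpret bounded_linear "S i" using lin[OF i] .
    show "norm (S i x) \<le> M * norm x"
    proof (cases "x = 0")
      case True
      then show ?thesis by (simp add: zero)
    next
      case False
      define c where "c = r / norm x"
      have c: "0 < c" using False r by (simp add: c_def)
      have "a + c *\<^sub>R x \<in> cball a r" "a \<in> cball a r"
        using False r by (auto simp: c_def dist_norm)
      then have "norm (S i (a + c *\<^sub>R x)) \<le> n" "norm (S i a) \<le> n"
        using r(2) i unfolding C_def by blast+
      moreover have "c *\<^sub>R S i x = S i (a + c *\<^sub>R x) - S i a" by (simp add: add scaleR)
      ultimately have "norm (c *\<^sub>R S i x) \<le> 2 * real n"
        using norm_triangle_ineq4[of "S i (a + c *\<^sub>R x)" "S i a"] by simp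
      then have "c * norm (S i x) \<le> 2 * real n" using c by simp
      then have "norm (S i x) \<le> (2 * real n / r) * norm x"
        using False r by (simp add: c_def field_simps)
      also have "\<dots> \<le> M * norm x" by (intro mult_right_mono) (simp_all add: M_def)
      finally show ?thesis .
    qed
  qed
qed

section \<open>Recurrent vectors\<close>

text \<open>The real-space extract of the hypotheses. \<open>convergent_subsequence\<close> is
  relative compactness of orbits in sequential form. \<open>norm_continuous\<close> is placed at
  time 1 because analyticity gives no operator-norm continuity at 0. One \<open>t0\<close> serves in
  both \<open>positive\<close> and \<open>irreducible\<close>, because every ideal below owes its
  invariance to positivity.\<close>

locale compact_positive_semigroup =
  fixes S :: "real \<Rightarrow> 'a :: banach_lattice \<Rightarrow> 'a" and t0 M :: real
  assumes linear: "0 \<le> t \<Longrightarrow> bounded_linear (S t)"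
    and semigroup: "0 \<le> s \<Longrightarrow> 0 \<le> t \<Longrightarrow> S (s + t) x = S s (S t x)"
    and at_zero: "S 0 x = x"
    and M_ge_1: "1 \<le> M"
    and bounded: "0 \<le> t \<Longrightarrow> norm (S t x) \<le> M * norm x"
    and t0_nonneg: "0 \<le> t0"
    and positive: "t0 \<le> t \<Longrightarrow> 0 \<le> x \<Longrightarrow> 0 \<le> S t x"
    and convergent_subsequence:
      "(\<And>n. 0 \<le> \<tau> n) \<Longrightarrow> \<exists>l r. strict_mono (r :: nat \<Rightarrow> nat) \<and> (\<lambda>n. S (\<tau> (r n)) x) \<longlonglongrightarrow> l"
    and norm_continuous: "0 < e \<Longrightarrow> \<exists>\<tau>>0. \<forall>t\<in>{0..\<tau>}. \<forall>x. norm (S (1 + t) x - S 1 x) \<le> e * norm x"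
    and irreducible: "subspace J \<Longrightarrow> closed J \<Longrightarrow> (\<And>x y. x \<in> J \<Longrightarrow> \<bar>y\<bar> \<le> \<bar>x\<bar> \<Longrightarrow> y \<in> J) \<Longrightarrow>
      (\<And>t x. t0 \<le> t \<Longrightarrow> x \<in> J \<Longrightarrow> S t x \<in> J) \<Longrightarrow> J = {0} \<or> J = UNIV"
begin

section \<open>Algebraic rules and order estimates\<close>

lemma diff: "0 \<le> t \<Longrightarrow> S t (x - y) = S t x - S t y"
  by (rule linear_simps(2)[OF linear])

lemma add: "0 \<le> t \<Longrightarrow> S t (x + y) = S t x + S t y"
  by (rule linear_simps(1)[OF linear])

lemma scale: "0 \<le> t \<Longrightarrow> S t (c *\<^sub>R x) = c *\<^sub>R S t x"
  by (rule linear_simps(5)[OF linear])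

lemma zero: "0 \<le> t \<Longrightarrow> S t 0 = 0"
  using scale[of t 0 0] by simp

lemma minus: "0 \<le> t \<Longrightarrow> S t (- x) = - S t x"
  using diff[of t 0 x] zero[of t] by simp

lemma commute: "0 \<le> s \<Longrightarrow> 0 \<le> t \<Longrightarrow> S s (S t x) = S t (S s x)"
  using semigroup[of s t x] semigroup[of t s x] by (simp add: add.commute)

lemma split: "0 \<le> s \<Longrightarrow> s \<le> t \<Longrightarrow> S (t - s) (S s x) = S t x"
  using semigroup[of "t - s" s x] by simp

lemma tendsto: "0 \<le> t \<Longrightarrow> (X \<longlongrightarrow> x) F \<Longrightarrow> ((\<lambda>n. S t (X n)) \<longlongrightarrow> S t x) F"
  using linear by (rule bounded_linear.tendsto)

lemma mono: "t0 \<le> t \<Longrightarrow> x \<le> y \<Longrightarrow> S t x \<le> S t y"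
  using positive[of t "y - x"] t0_nonneg by (simp add: diff)

lemma abs_le: "t0 \<le> t \<Longrightarrow> \<bar>S t x\<bar> \<le> S t \<bar>x\<bar>"
  using mono[of t x "\<bar>x\<bar>"] mono[of t "- x" "\<bar>x\<bar>"] t0_nonneg
  by (intro abs_leI) (simp_all add: minus abs_ge_minus_self abs_ge_self)

lemma M_pos: "0 < M"
  using M_ge_1 by simp

text \<open>One small value controls the whole later orbit up to the factor \<open>M\<close>, so the
  times \<open>t n\<close> need not tend to infinity.\<close>

lemma tends_to_zero:
  assumes t: "\<And>n. 0 \<le> t n" and lim: "(\<lambda>n. S (t n) w) \<longlonglongrightarrow> 0"
  shows "((\<lambda>s. S s w) \<longlongrightarrow> 0) at_top"
proof (rule tendstoI)
  fix e :: real assume "0 < e"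
  then have "0 < e / M" using M_pos by simp
  then obtain n where n: "norm (S (t n) w) < e / M"
    using LIMSEQ_D[OF lim] by (metis diff_zero order_refl)
  have "norm (S s w) < e" if "t n \<le> s" for s
  proof -
    have "norm (S s w) \<le> M * norm (S (t n) w)"
      using split[OF t that] bounded[of "s - t n" "S (t n) w"] that by simp
    also have "\<dots> < e" using n M_pos by (simp add: field_simps)
    finally show ?thesis .
  qed
  then show "\<forall>\<^sub>F s in at_top. dist (S s w) 0 < e"
    unfolding eventually_at_top_linorder by auto
qed

text \<open>In dynamical terms, \<open>g\<close> lies in its own omega-limit set. \<open>N\<close>
  may be negative, hence the separate bound \<open>0 \<le> t\<close>.\<close>

definition recurrent :: "'a \<Rightarrow> bool"
  where "recurrent g \<longleftrightarrow> (\<forall>e>0. \<forall>N. \<exists>t\<ge>N. 0 \<le> t \<and> norm (S t g - g) < e)"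

lemma recurrentD:
  assumes "recurrent g" "0 < e"
  obtains t where "N \<le> t" "0 \<le> t" "norm (S t g - g) < e"
  using assms unfolding recurrent_def by blast

lemma recurrent_orbit:
  assumes "recurrent g" "0 \<le> s"
  shows "recurrent (S s g)"
  unfolding recurrent_def
proof (intro allI impI)
  fix e N :: real assume "0 < e"
  then have "0 < e / M" using M_pos by simp
  with assms(1) obtain t where t: "N \<le> t" "0 \<le> t" "norm (S t g - g) < e / M"
    by (rule recurrentD)
  have "norm (S t (S s g) - S s g) = norm (S s (S t g - g))"
    using t assms(2) by (simp add: diff commute)
  also have "\<dots> \<le> M * norm (S t g - g)" using assms(2) by (rule bounded)
  also have "\<dots> < e" using t M_pos by (simp add: field_simps)
  finally show "\<exists>t\<ge>N. 0 \<le> t \<and> norm (S t (S s g) - S s g) < e" using t by blast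
qed

lemma recurrent_limit:
  assumes rec: "\<And>n. recurrent (X n)" and lim: "X \<longlonglongrightarrow> g"
  shows "recurrent g"
  unfolding recurrent_def
proof (intro allI impI)
  fix e N :: real assume e: "0 < e"
  \<comment> \<open>\<open>g\<close> is replaced by \<open>X n\<close> twice, directly and under
    \<open>S t\<close>, at a total cost of \<open>(M + 1) * d = e / 2\<close>.\<close>
  define d where "d = e / 2 / (M + 1)"
  have "0 < d" using e M_pos by (simp add: d_def)
  then obtain n where n: "norm (X n - g) < d" using LIMSEQ_D[OF lim] by blast
  obtain t where t: "N \<le> t" "0 \<le> t" "norm (S t (X n) - X n) < e / 2"
    using recurrentD[OF rec, of "e / 2"] e by auto
  have eq: "S t g - g = (X n - g) + (S t (X n) - X n) - S t (X n - g)"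
    using t by (simp add: diff)
  have "norm (S t g - g) \<le> norm (X n - g) + norm (S t (X n) - X n) + norm (S t (X n - g))"
    unfolding eq
    using norm_triangle_ineq4[of "(X n - g) + (S t (X n) - X n)" "S t (X n - g)"]
      norm_triangle_ineq[of "X n - g" "S t (X n) - X n"] by linarith
  also have "\<dots> \<le> norm (X n - g) + norm (S t (X n) - X n) + M * norm (X n - g)"
    using t by (simp add: bounded)
  also have "\<dots> < d + e / 2 + M * d"
    using n t M_pos by (intro add_strict_mono add_less_le_mono mult_strict_left_mono) auto
  also have "\<dots> = (M + 1) * d + e / 2" by (simp add: algebra_simps)
  also have "(M + 1) * d = e / 2"
  proof -
    have "M + 1 \<noteq> 0" using M_pos by simp
    then show ?thesis unfolding d_def by (metis nonzero_mult_div_cancel_left times_divide_eq_right)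
  qed
  also have "e / 2 + e / 2 = e" by simp
  finally show "\<exists>t\<ge>N. 0 \<le> t \<and> norm (S t g - g) < e" using t by blast
qed

text \<open>After time \<open>s\<close> the orbit must still come back to \<open>g\<close>, and the
  way back enlarges norms by at most the factor \<open>M\<close>.\<close>

lemma recurrent_lower_bound:
  assumes "recurrent g" "0 \<le> s"
  shows "norm g \<le> M * norm (S s g)"
proof (rule field_le_epsilon)
  fix e :: real assume "0 < e"
  with assms(1) obtain t where t: "s \<le> t" "norm (S t g - g) < e"
    by (rule recurrentD[where N = s])
  have "norm (S t g) \<le> M * norm (S s g)"
    using split[OF assms(2) t(1)] bounded[of "t - s" "S s g"] t by simp
  then show "norm g \<le> M * norm (S s g) + e"
    using t(2) norm_triangle_sub[of g "S t g"] by (simp add: norm_minus_commute)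
qed

text \<open>\<open>S d\<close> commutes with the semigroup, so the return times of \<open>g\<close>
  serve for its increment too. Closure under arbitrary differences comes later and rests on this
  special case.\<close>

lemma recurrent_increment:
  assumes "recurrent g" "0 \<le> d"
  shows "recurrent (S d g - g)"
  unfolding recurrent_def
proof (intro allI impI)
  fix e N :: real assume e: "0 < e"
  have "0 < e / (M + 1)" using e M_pos by simp
  with assms(1) obtain t where t: "N \<le> t" "0 \<le> t" "norm (S t g - g) < e / (M + 1)"
    by (rule recurrentD)
  have "S t (S d g - g) - (S d g - g) = S d (S t g - g) - (S t g - g)"
    using t assms(2) by (simp add: diff commute)
  then have "norm (S t (S d g - g) - (S d g - g)) \<le> norm (S d (S t g - g)) + norm (S t g - g)"
    by (metis norm_triangle_ineq4)
  also have "\<dots> \<le> (M + 1) * norm (S t g - g)"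
    using bounded[OF assms(2), of "S t g - g"] by (simp add: algebra_simps)
  also have "\<dots> < e" using t M_pos by (simp add: field_simps)
  finally show "\<exists>t\<ge>N. 0 \<le> t \<and> norm (S t (S d g - g) - (S d g - g)) < e" using t by blast
qed

text \<open>\<open>S s\<close> maps the increment on the left to the difference on the right and is
  bounded below on it. Two close points of an orbit thus make their time difference an approximate
  return time.\<close>

lemma increment_le:
  assumes "recurrent g" "0 \<le> s" "s \<le> t"
  shows "norm (S (t - s) g - g) \<le> M * norm (S t g - S s g)"
proof -
  have "S s (S (t - s) g - g) = S t g - S s g"
    using assms semigroup[of s "t - s" g] by (simp add: diff)
  then show ?thesis
    using recurrent_lower_bound[OF recurrent_increment[OF assms(1)], of "t - s" s] assms by simp
qed

text \<open>
  Two recurrent vectors return simultaneously: along a sequence of times at which both orbits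
  converge, the differences of these times are common return times, because the semigroup is
  bounded below on recurrent vectors.
\<close>

lemma recurrent_pair:
  assumes "recurrent g" "recurrent k" "0 < e"
  shows "\<exists>t\<ge>N. 0 \<le> t \<and> norm (S t g - g) < e \<and> norm (S t k - k) < e"
proof -
  obtain l1 and r1 :: "nat \<Rightarrow> nat" where r1: "strict_mono r1" "(\<lambda>n. S (real (r1 n)) g) \<longlonglongrightarrow> l1"
    using convergent_subsequence[of real g] by auto
  obtain l2 and r2 :: "nat \<Rightarrow> nat"
    where r2: "strict_mono r2" "(\<lambda>n. S (real (r1 (r2 n))) k) \<longlonglongrightarrow> l2"
    using convergent_subsequence[of "\<lambda>n. real (r1 n)" k] by auto
  define r where "r = r1 \<circ> r2"
  have r: "strict_mono r" unfolding r_def using r1(1) r2(1) by (rule strict_mono_o)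
  have "(\<lambda>n. S (real (r n)) g) \<longlonglongrightarrow> l1"
    using LIMSEQ_subseq_LIMSEQ[OF r1(2) r2(1)] by (simp add: r_def o_def)
  then have cg: "Cauchy (\<lambda>n. S (real (r n)) g)" by (rule LIMSEQ_imp_Cauchy)
  have "(\<lambda>n. S (real (r n)) k) \<longlonglongrightarrow> l2" using r2(2) by (simp add: r_def)
  then have ck: "Cauchy (\<lambda>n. S (real (r n)) k)" by (rule LIMSEQ_imp_Cauchy)
  have eM: "0 < e / M" using assms(3) M_pos by simp
  obtain n1 where n1: "\<And>i j. n1 \<le> i \<Longrightarrow> n1 \<le> j \<Longrightarrow> norm (S (real (r i)) g - S (real (r j)) g) < e / M"
    using CauchyD[OF cg eM] by blast
  obtain n2 where n2: "\<And>i j. n2 \<le> i \<Longrightarrow> n2 \<le> j \<Longrightarrow> norm (S (real (r i)) k - S (real (r j)) k) < e / M"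
    using CauchyD[OF ck eM] by blast
  define i where "i = max n1 n2"
  \<comment> \<open>Since \<open>r j \<ge> j\<close>, this index puts \<open>r j\<close> at least
    \<open>N\<close> beyond \<open>r i\<close>, while \<open>j \<ge> i\<close> keeps it in the range
    of both Cauchy estimates.\<close>
  define j where "j = i + r i + nat \<lceil>N\<rceil>"
  have "real (r j) \<ge> real j" using strict_mono_imp_increasing[OF r] by simp
  then have t: "real (r i) \<le> real (r j)" "N \<le> real (r j) - real (r i)"
    unfolding j_def by linarith+
  have "norm (S (real (r j) - real (r i)) g - g) \<le> M * norm (S (real (r j)) g - S (real (r i)) g)"
    by (rule increment_le[OF assms(1) _ t(1)]) simp
  also have "\<dots> < e" using n1[of j i] M_pos by (simp add: i_def j_def field_simps)
  finally have g: "norm (S (real (r j) - real (r i)) g - g) < e" .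
  have "norm (S (real (r j) - real (r i)) k - k) \<le> M * norm (S (real (r j)) k - S (real (r i)) k)"
    by (rule increment_le[OF assms(2) _ t(1)]) simp
  also have "\<dots> < e" using n2[of j i] M_pos by (simp add: i_def j_def field_simps)
  finally have k: "norm (S (real (r j) - real (r i)) k - k) < e" .
  show ?thesis using g k t by (intro exI[of _ "real (r j) - real (r i)"]) simp
qed

lemma recurrent_pair_sequence:
  assumes "recurrent g" "recurrent k"
  obtains t where "\<And>n. N \<le> t n" "\<And>n. 0 \<le> t n" "\<And>n. real n \<le> t n"
    "(\<lambda>n. S (t n) g) \<longlonglongrightarrow> g" "(\<lambda>n. S (t n) k) \<longlonglongrightarrow> k"
proof -
  have "\<exists>t\<ge>max N (real n). 0 \<le> t \<and> norm (S t g - g) < inverse (Suc n)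
      \<and> norm (S t k - k) < inverse (Suc n)" for n
    using assms by (intro recurrent_pair) auto
  then obtain t where t: "\<And>n. max N (real n) \<le> t n \<and> 0 \<le> t n \<and>
      norm (S (t n) g - g) < inverse (Suc n) \<and> norm (S (t n) k - k) < inverse (Suc n)"
    by metis
  have "(\<lambda>n. S (t n) x) \<longlonglongrightarrow> x" if "\<And>n. norm (S (t n) x - x) < inverse (Suc n)" for x
  proof -
    have "(\<lambda>n. S (t n) x - x) \<longlonglongrightarrow> 0"
      by (rule Lim_null_comparison[OF always_eventually LIMSEQ_inverse_real_of_nat])
        (use that in \<open>auto intro: less_imp_le\<close>)
    then show ?thesis by (rule LIM_zero_cancel)
  qed
  with t show thesis by (intro that[of t]) auto
qed

section \<open>The subspace of recurrent vectors\<close>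

lemma recurrent_add:
  assumes "recurrent g" "recurrent k"
  shows "recurrent (g + k)"
  unfolding recurrent_def
proof (intro allI impI)
  fix e N :: real assume "0 < e"
  then obtain t where t: "N \<le> t" "0 \<le> t" "norm (S t g - g) < e / 2" "norm (S t k - k) < e / 2"
    using recurrent_pair[OF assms, of "e / 2"] by auto
  have eq: "S t (g + k) - (g + k) = (S t g - g) + (S t k - k)" using t by (simp add: add)
  have "norm (S t (g + k) - (g + k)) < e"
    unfolding eq
    using norm_triangle_ineq[of "S t g - g" "S t k - k"] t by linarith
  then show "\<exists>t\<ge>N. 0 \<le> t \<and> norm (S t (g + k) - (g + k)) < e" using t by blast
qed

lemma recurrent_scale:
  assumes "recurrent g"
  shows "recurrent (c *\<^sub>R g)"
proof -
  obtain t where t: "\<And>n. 0 \<le> t n" "\<And>n. real n \<le> t n" "(\<lambda>n. S (t n) g) \<longlonglongrightarrow> g"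
    using recurrent_pair_sequence[OF assms assms] by metis
  have lim: "(\<lambda>n. S (t n) (c *\<^sub>R g)) \<longlonglongrightarrow> c *\<^sub>R g"
    using tendsto_scaleR[OF tendsto_const t(3)] t(1) by (simp add: scale)
  show ?thesis
    unfolding recurrent_def
  proof (intro allI impI)
    fix e N :: real assume "0 < e"
    then obtain n where n: "\<And>m. n \<le> m \<Longrightarrow> norm (S (t m) (c *\<^sub>R g) - c *\<^sub>R g) < e"
      using LIMSEQ_D[OF lim] by blast
    have "N \<le> t (max n (nat \<lceil>N\<rceil>))" using t(2)[of "max n (nat \<lceil>N\<rceil>)"] by linarith
    then show "\<exists>t\<ge>N. 0 \<le> t \<and> norm (S t (c *\<^sub>R g) - c *\<^sub>R g) < e"
      using n[of "max n (nat \<lceil>N\<rceil>)"] t(1) by auto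
  qed
qed

lemma recurrent_diff: "recurrent g \<Longrightarrow> recurrent k \<Longrightarrow> recurrent (g - k)"
  using recurrent_add[of g "(- 1) *\<^sub>R k"] recurrent_scale[of k "- 1"] by simp

text \<open>For return times \<open>s n\<close> of \<open>y\<close>, the vectors
  \<open>S (s n - t) y\<close> have a limit point by compactness, and \<open>S t\<close> carries it
  to \<open>y\<close>. By \<open>recurrent_lower_bound\<close> it is the only recurrent
  preimage.\<close>

lemma recurrent_preimage:
  assumes y: "recurrent y" and t: "0 \<le> t"
  obtains h where "recurrent h" "S t h = y" "norm h \<le> M * norm y"
proof -
  obtain s where s: "\<And>n. t \<le> s n" "(\<lambda>n. S (s n) y) \<longlonglongrightarrow> y"
    using recurrent_pair_sequence[OF y y, of t] by metis
  obtain h and r :: "nat \<Rightarrow> nat" where r: "strict_mono r" "(\<lambda>n. S (s (r n) - t) y) \<longlonglongrightarrow> h"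
    using convergent_subsequence[of "\<lambda>n. s n - t" y] s(1) by auto
  have "(\<lambda>n. S t (S (s (r n) - t) y)) \<longlonglongrightarrow> S t h" using t r(2) by (rule tendsto)
  moreover have "S t (S (s (r n) - t) y) = S (s (r n)) y" for n
    using semigroup[of t "s (r n) - t" y] t s(1)[of "r n"] by simp
  moreover have "(\<lambda>n. S (s (r n)) y) \<longlonglongrightarrow> y"
    using LIMSEQ_subseq_LIMSEQ[OF s(2) r(1)] by (simp add: o_def)
  ultimately have "S t h = y" using LIMSEQ_unique by simp
  moreover have "recurrent h"
    using s(1) by (intro recurrent_limit[OF _ r(2)] recurrent_orbit y) simp
  moreover have "norm h \<le> M * norm y"
    by (rule LIMSEQ_le_const2[OF tendsto_norm[OF r(2)]]) (use s(1) bounded in auto)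
  ultimately show thesis using that by blast
qed

text \<open>Once the orbit is positive at time \<open>t\<close>, it is positive from
  \<open>t + t0\<close> on; return times of \<open>h\<close> beyond that hand the sign back to
  \<open>h\<close>.\<close>

lemma recurrent_nonneg_cancel:
  assumes h: "recurrent h" and t: "0 \<le> t" and pos: "0 \<le> S t h"
  shows "0 \<le> h"
proof -
  obtain s where s: "\<And>n. t + t0 \<le> s n" "(\<lambda>n. S (s n) h) \<longlonglongrightarrow> h"
    using recurrent_pair_sequence[OF h h, of "t + t0"] by metis
  have "0 \<le> S (s n) h" for n
  proof -
    have "t0 \<le> s n - t" "t \<le> s n" using s(1)[of n] t0_nonneg by linarith+
    then show ?thesis using positive[OF _ pos, of "s n - t"] t split[of t "s n" h] by simp
  qed
  with s(2) show ?thesis by (rule LIMSEQ_nonneg_lattice)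
qed

text \<open>This covers times below \<open>t0\<close>: applying \<open>S t0\<close> makes the vector
  positive, and \<open>recurrent_nonneg_cancel\<close> removes \<open>S t0\<close> again.\<close>

lemma recurrent_nonneg_orbit:
  assumes h: "recurrent h" and t: "0 \<le> t" and pos: "0 \<le> h"
  shows "0 \<le> S t h"
proof -
  have "0 \<le> S t0 (S t h)"
    using semigroup[of t0 t h] positive[of "t0 + t" h] t t0_nonneg pos by simp
  then show ?thesis
    using recurrent_nonneg_cancel[OF recurrent_orbit[OF h t]] t0_nonneg by blast
qed

text \<open>The time from one late visit near \<open>y\<close> to a much later one is an approximate
  return time of \<open>y\<close>.\<close>

lemma orbit_limit_recurrent:
  assumes n: "\<And>i. real i \<le> n i" and lim: "(\<lambda>i. S (n i) x) \<longlonglongrightarrow> y"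
  shows "recurrent y"
  unfolding recurrent_def
proof (intro allI impI)
  fix e N :: real assume e: "0 < e"
  have n0: "0 \<le> n i" for i using n[of i] by linarith
  define d where "d = e / (M + 1)"
  have "0 < d" using e M_pos by (simp add: d_def)
  then obtain i where i: "\<And>j. i \<le> j \<Longrightarrow> norm (S (n j) x - y) < d"
    using LIMSEQ_D[OF lim] by blast
  \<comment> \<open>The times \<open>n i\<close> need not be monotone; \<open>n j \<ge> j\<close>
    and the term \<open>max N 0\<close> secure both \<open>N \<le> t\<close> and
    \<open>0 \<le> t\<close>.\<close>
  define j where "j = i + nat \<lceil>n i + max N 0\<rceil>"
  define t where "t = n j - n i"
  have t: "N \<le> t" "0 \<le> t"
    using n[of j] unfolding t_def j_def by linarith+
  have "S t y - y = (S (n j) x - y) - S t (S (n i) x - y)"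
    using t n0[of i] semigroup[of t "n i" x] by (simp add: diff t_def)
  then have "norm (S t y - y) \<le> norm (S (n j) x - y) + norm (S t (S (n i) x - y))"
    by (metis norm_triangle_ineq4)
  also have "\<dots> \<le> norm (S (n j) x - y) + M * norm (S (n i) x - y)"
    using t by (simp add: bounded)
  also have "\<dots> < d + M * d"
    using i[of i] i[of j] M_pos by (intro add_strict_mono mult_strict_left_mono) (auto simp: j_def)
  also have "\<dots> = (M + 1) * d" by (simp add: algebra_simps)
  also have "\<dots> = e" using M_pos by (simp add: d_def)
  finally show "\<exists>t\<ge>N. 0 \<le> t \<and> norm (S t y - y) < e" using t by blast
qed

text \<open>The Jacobs--de Leeuw--Glicksberg decomposition into a recurrent and a stable part.\<close>

lemma recurrent_decomposition:
  obtains k where "recurrent k" "((\<lambda>t. S t (x - k)) \<longlongrightarrow> 0) at_top"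
proof -
  obtain y and n :: "nat \<Rightarrow> nat" where n: "strict_mono n" "(\<lambda>i. S (real (n i)) x) \<longlonglongrightarrow> y"
    using convergent_subsequence[of real x] by auto
  have "real i \<le> real (n i)" for i using strict_mono_imp_increasing[OF n(1)] by simp
  then have y: "recurrent y" using n(2) by (rule orbit_limit_recurrent)
  \<comment> \<open>The return times of \<open>y\<close> are taken beyond \<open>n i\<close>, so
    that \<open>y\<close> can be followed for the nonnegative time \<open>s i - n i\<close>.\<close>
  have "\<exists>s\<ge>real (n i). 0 \<le> s \<and> norm (S s y - y) < inverse (Suc i)" for i
    using y unfolding recurrent_def by (metis inverse_positive_iff_positive of_nat_0_less_iff zero_less_Suc)
  then obtain s where s: "\<And>i. real (n i) \<le> s i" "\<And>i. norm (S (s i) y - y) < inverse (Suc i)"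
    by metis
  have "(\<lambda>i. S (s i) y - y) \<longlonglongrightarrow> 0"
    by (rule Lim_null_comparison[OF always_eventually LIMSEQ_inverse_real_of_nat])
      (use s in \<open>auto intro: less_imp_le\<close>)
  then have sy: "(\<lambda>i. S (s i) y) \<longlonglongrightarrow> y" by (rule LIM_zero_cancel)
  \<comment> \<open>\<open>k\<close> imitates the image of \<open>y\<close> under the inverse of
    \<open>S (n i)\<close>: along the subsequence \<open>S (n i) k\<close> is close to
    \<open>S (s i) y\<close>, hence to \<open>y\<close>, and so to \<open>S (n i) x\<close>.\<close>
  obtain k and r :: "nat \<Rightarrow> nat" where r: "strict_mono r" "(\<lambda>i. S (s (r i) - n (r i)) y) \<longlonglongrightarrow> k"
    using convergent_subsequence[of "\<lambda>i. s i - n i" y] s(1) by auto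
  have k: "recurrent k"
    using s(1) by (intro recurrent_limit[OF _ r(2)] recurrent_orbit y) simp
  have nr: "(\<lambda>i. S (real (n (r i))) x) \<longlonglongrightarrow> y" "(\<lambda>i. S (s (r i)) y) \<longlonglongrightarrow> y"
    using LIMSEQ_subseq_LIMSEQ[OF n(2) r(1)] LIMSEQ_subseq_LIMSEQ[OF sy r(1)] by (simp_all add: o_def)
  have "(\<lambda>i. S (real (n (r i))) (S (s (r i) - n (r i)) y - k)) \<longlonglongrightarrow> 0"
  proof (rule Lim_null_comparison)
    show "\<forall>\<^sub>F i in sequentially. norm (S (real (n (r i))) (S (s (r i) - n (r i)) y - k))
        \<le> M * norm (S (s (r i) - n (r i)) y - k)"
      by (intro always_eventually allI bounded) simp
    show "(\<lambda>i. M * norm (S (s (r i) - n (r i)) y - k)) \<longlonglongrightarrow> 0"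
      using tendsto_mult[OF tendsto_const tendsto_norm_zero[OF LIM_zero[OF r(2)]], of M] by simp
  qed
  moreover have "S (real (n (r i))) (S (s (r i) - n (r i)) y - k)
      = S (s (r i)) y - S (real (n (r i))) k" for i
    using s(1)[of "r i"] semigroup[of "real (n (r i))" "s (r i) - n (r i)" y] by (simp add: diff)
  ultimately have "(\<lambda>i. S (s (r i)) y - S (real (n (r i))) k) \<longlonglongrightarrow> 0" by simp
  from tendsto_diff[OF nr(1) tendsto_diff[OF nr(2) this]]
  have "(\<lambda>i. S (real (n (r i))) (x - k)) \<longlonglongrightarrow> 0"
    by (simp add: diff)
  then have "((\<lambda>t. S t (x - k)) \<longlongrightarrow> 0) at_top"
    by (rule tends_to_zero[rotated]) simp
  with k show thesis by (rule that)
qed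

text \<open>Writing \<open>x = S 1 h\<close> turns continuity at time 1 into continuity at time 0.
  The tolerance \<open>1 / (2 * M)\<close> absorbs the growth from \<open>x\<close> to
  \<open>h\<close>; in place of 1/2 any factor below 1 would serve.\<close>

lemma recurrent_small_increment:
  obtains \<tau> where "0 < \<tau>" "\<And>t x. 0 \<le> t \<Longrightarrow> t \<le> \<tau> \<Longrightarrow> recurrent x \<Longrightarrow> norm (S t x - x) \<le> norm x / 2"
proof -
  have "0 < 1 / (2 * M)" using M_pos by simp
  from norm_continuous[OF this] obtain \<tau> where \<tau>: "0 < \<tau>"
      "\<And>t x. 0 \<le> t \<Longrightarrow> t \<le> \<tau> \<Longrightarrow> norm (S (1 + t) x - S 1 x) \<le> 1 / (2 * M) * norm x"
    by auto
  show thesis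
  proof (rule that[OF \<tau>(1)])
    fix t x assume t: "0 \<le> t" "t \<le> \<tau>" and x: "recurrent x"
    obtain h where h: "S 1 h = x" "norm h \<le> M * norm x"
      using recurrent_preimage[OF x, of 1] by auto
    have "norm (S t x - x) = norm (S (1 + t) h - S 1 h)"
      using h(1) semigroup[of t 1 h] t by (simp add: add.commute)
    also have "\<dots> \<le> 1 / (2 * M) * norm h" using t by (rule \<tau>(2))
    also have "\<dots> \<le> 1 / (2 * M) * (M * norm x)" using h(2) M_pos by (intro mult_left_mono) auto
    also have "\<dots> = norm x / 2" using M_pos by simp
    finally show "norm (S t x - x) \<le> norm x / 2" .
  qed
qed

end

section \<open>The recurrent vectors of a semigroup that does not vanish at infinity\<close>

locale nonvanishing_positive_semigroup = compact_positive_semigroup +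
  assumes nonvanishing: "\<exists>x. \<not> ((\<lambda>t. S t x) \<longlongrightarrow> 0) at_top"
begin

section \<open>Stable positive vectors and the sublattice of recurrent vectors\<close>

lemma tendsto_zero_mono:
  assumes "0 \<le> a" "a \<le> b" "((\<lambda>t. S t b) \<longlongrightarrow> 0) at_top"
  shows "((\<lambda>t. S t a) \<longlongrightarrow> 0) at_top"
proof (rule Lim_null_comparison)
  have "norm (S t a) \<le> norm (S t b)" if "t0 \<le> t" for t
    using that assms(1,2) positive mono by (intro norm_mono_nonneg)
  then show "\<forall>\<^sub>F t in at_top. norm (S t a) \<le> norm (S t b)"
    unfolding eventually_at_top_linorder by blast
  show "((\<lambda>t. norm (S t b)) \<longlongrightarrow> 0) at_top" using assms(3) by (rule tendsto_norm_zero)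
qed

lemma eventually_ge_zero: "\<forall>\<^sub>F t in at_top. (0::real) \<le> t"
  by (rule eventually_ge_at_top)

lemma stable_nonneg_zero:
  assumes w: "0 \<le> w" and lim: "((\<lambda>t. S t w) \<longlongrightarrow> 0) at_top"
  shows "w = 0"
proof -
  define J where "J = {f. ((\<lambda>t. S t \<bar>f\<bar>) \<longlongrightarrow> 0) at_top}"
  have J: "y \<in> J" if "x \<in> J" "\<bar>y\<bar> \<le> \<bar>x\<bar>" for x y
    using that unfolding J_def by (auto intro: tendsto_zero_mono)
  have sub: "subspace J"
    unfolding subspace_def
  proof (intro conjI ballI allI)
    have "\<forall>\<^sub>F t in at_top. S t 0 = 0"
      using eventually_ge_zero by eventually_elim (rule zero)
    then show "0 \<in> J" unfolding J_def by (simp add: tendsto_eventually)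
  next
    fix x y assume "x \<in> J" "y \<in> J"
    then have "((\<lambda>t. S t \<bar>x\<bar> + S t \<bar>y\<bar>) \<longlongrightarrow> 0 + 0) at_top"
      unfolding J_def by (intro tendsto_add) auto
    moreover have "\<forall>\<^sub>F t in at_top. S t \<bar>x\<bar> + S t \<bar>y\<bar> = S t (\<bar>x\<bar> + \<bar>y\<bar>)"
      using eventually_ge_zero by eventually_elim (simp add: add)
    ultimately have "((\<lambda>t. S t (\<bar>x\<bar> + \<bar>y\<bar>)) \<longlongrightarrow> 0 + 0) at_top"
      by (rule Lim_transform_eventually)
    then have "((\<lambda>t. S t (\<bar>x\<bar> + \<bar>y\<bar>)) \<longlongrightarrow> 0) at_top" by simp
    then show "x + y \<in> J"
      unfolding J_def using tendsto_zero_mono[OF abs_ge_zero abs_triangle_ineq] by blast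
  next
    fix c x assume "x \<in> J"
    then have "((\<lambda>t. \<bar>c\<bar> *\<^sub>R S t \<bar>x\<bar>) \<longlongrightarrow> \<bar>c\<bar> *\<^sub>R 0) at_top"
      unfolding J_def by (intro tendsto_scaleR tendsto_const) auto
    moreover have "\<forall>\<^sub>F t in at_top. \<bar>c\<bar> *\<^sub>R S t \<bar>x\<bar> = S t (\<bar>c\<bar> *\<^sub>R \<bar>x\<bar>)"
      using eventually_ge_zero by eventually_elim (simp add: scale)
    ultimately have "((\<lambda>t. S t (\<bar>c\<bar> *\<^sub>R \<bar>x\<bar>)) \<longlongrightarrow> \<bar>c\<bar> *\<^sub>R 0) at_top"
      by (rule Lim_transform_eventually)
    then have "((\<lambda>t. S t (\<bar>c\<bar> *\<^sub>R \<bar>x\<bar>)) \<longlongrightarrow> 0) at_top" by simp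
    then show "c *\<^sub>R x \<in> J"
      unfolding J_def using tendsto_zero_mono[OF abs_ge_zero abs_scaleR_le_abs] by blast
  qed
  have clo: "closed J"
    unfolding closed_sequential_limits
  proof (intro allI impI, elim conjE)
    fix X x assume X: "\<forall>n. X n \<in> J" and Xx: "X \<longlonglongrightarrow> x"
    have "((\<lambda>t. S t \<bar>x\<bar>) \<longlongrightarrow> 0) at_top"
    proof (rule tendstoI)
      fix e :: real assume e: "0 < e"
      then have "0 < e / 2 / M" using M_pos by simp
      then obtain n where n: "norm (X n - x) < e / 2 / M"
        using LIMSEQ_D[OF Xx] by blast
      have "((\<lambda>t. S t \<bar>X n\<bar>) \<longlongrightarrow> 0) at_top" using X unfolding J_def by blast
      then have "\<forall>\<^sub>F t in at_top. dist (S t \<bar>X n\<bar>) 0 < e / 2" using e by (intro tendstoD) auto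
      then show "\<forall>\<^sub>F t in at_top. dist (S t \<bar>x\<bar>) 0 < e"
        using eventually_ge_zero
      proof eventually_elim
        case (elim t)
        have "norm (S t (\<bar>X n\<bar> - \<bar>x\<bar>)) \<le> M * norm (\<bar>X n\<bar> - \<bar>x\<bar>)" using elim(2) by (rule bounded)
        also have "\<dots> \<le> M * norm (X n - x)" using M_pos norm_abs_diff_le by (simp add: mult_left_mono)
        also have "\<dots> < e / 2" using n M_pos by (simp add: field_simps)
        finally have "norm (S t \<bar>X n\<bar> - S t \<bar>x\<bar>) < e / 2" using elim(2) by (simp add: diff)
        then show ?case
          using elim(1) norm_triangle_sub[of "S t \<bar>x\<bar>" "S t \<bar>X n\<bar>"]
          by (simp add: norm_minus_commute)
      qed
    qed
    then show "x \<in> J" unfolding J_def by blast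
  qed
  have inv: "S t x \<in> J" if t: "t0 \<le> t" and x: "x \<in> J" for t x
  proof -
    have t': "0 \<le> t" using t t0_nonneg by simp
    have "((\<lambda>s. S t (S s \<bar>x\<bar>)) \<longlongrightarrow> S t 0) at_top"
      using x t' unfolding J_def by (intro tendsto) auto
    moreover have "\<forall>\<^sub>F s in at_top. S t (S s \<bar>x\<bar>) = S s (S t \<bar>x\<bar>)"
      using eventually_ge_zero by eventually_elim (use t' in \<open>simp add: commute\<close>)
    ultimately have "((\<lambda>s. S s (S t \<bar>x\<bar>)) \<longlongrightarrow> S t 0) at_top"
      by (rule Lim_transform_eventually)
    then have "((\<lambda>s. S s (S t \<bar>x\<bar>)) \<longlongrightarrow> 0) at_top" using t' by (simp add: zero)
    then show ?thesis
      unfolding J_def using tendsto_zero_mono[OF abs_ge_zero abs_le[OF t]] by blast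
  qed
  \<comment> \<open>If the orbit of every \<open>\<bar>x\<bar>\<close> tended to 0, the eventual
    domination of \<open>\<bar>S t x\<bar>\<close> by \<open>S t \<bar>x\<bar>\<close> would force
    every orbit to 0.\<close>
  have "J \<noteq> UNIV"
  proof
    assume "J = UNIV"
    have "((\<lambda>t. S t x) \<longlongrightarrow> 0) at_top" for x
    proof (rule Lim_null_comparison)
      have "norm (S t x) \<le> norm (S t \<bar>x\<bar>)" if "t0 \<le> t" for t
        using norm_mono_nonneg[OF abs_ge_zero abs_le[OF that]] by simp
      then show "\<forall>\<^sub>F t in at_top. norm (S t x) \<le> norm (S t \<bar>x\<bar>)"
        unfolding eventually_at_top_linorder by blast
      have "x \<in> J" using \<open>J = UNIV\<close> by simp
      then show "((\<lambda>t. norm (S t \<bar>x\<bar>)) \<longlongrightarrow> 0) at_top"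
        unfolding J_def by (intro tendsto_norm_zero) simp
    qed
    then show False using nonvanishing by blast
  qed
  moreover have "J = {0} \<or> J = UNIV" using sub clo J inv by (rule irreducible)
  moreover have "w \<in> J" using w lim by (simp add: J_def)
  ultimately show ?thesis by blast
qed

text \<open>Let \<open>k\<close> be the recurrent part of \<open>\<bar>g\<bar>\<close>. Along common
  return times of \<open>g\<close> and \<open>k\<close> the stable part drops out, and
  \<open>\<bar>S t g\<bar> \<le> S t \<bar>g\<bar>\<close> becomes
  \<open>\<bar>g\<bar> \<le> k\<close>. Then \<open>k - \<bar>g\<bar>\<close> is positive and
  stable, hence 0.\<close>

lemma recurrent_abs:
  assumes g: "recurrent g"
  shows "recurrent \<bar>g\<bar>"
proof -
  obtain k where k: "recurrent k" "((\<lambda>t. S t (\<bar>g\<bar> - k)) \<longlongrightarrow> 0) at_top"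
    by (rule recurrent_decomposition)
  obtain s where s: "\<And>n. t0 \<le> s n" "\<And>n. 0 \<le> s n" "\<And>n. real n \<le> s n"
      "(\<lambda>n. S (s n) g) \<longlonglongrightarrow> g" "(\<lambda>n. S (s n) k) \<longlonglongrightarrow> k"
    using recurrent_pair_sequence[OF g k(1), where N = t0] by blast
  have "filterlim s at_top sequentially"
    by (rule filterlim_at_top_mono[OF filterlim_real_sequentially]) (use s(3) in simp)
  then have "(\<lambda>n. S (s n) (\<bar>g\<bar> - k)) \<longlonglongrightarrow> 0" by (rule filterlim_compose[OF k(2)])
  from tendsto_add[OF this s(5)] have "(\<lambda>n. S (s n) \<bar>g\<bar>) \<longlonglongrightarrow> k"
    by (simp add: diff s(2))
  then have "\<bar>g\<bar> \<le> k"
    by (rule LIMSEQ_le_lattice[OF tendsto_abs_lattice[OF s(4)] _ abs_le[OF s(1)]])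
  moreover have "((\<lambda>t. S t (k - \<bar>g\<bar>)) \<longlongrightarrow> 0) at_top"
  proof (rule Lim_transform_eventually)
    show "((\<lambda>t. - S t (\<bar>g\<bar> - k)) \<longlongrightarrow> 0) at_top" using tendsto_minus[OF k(2)] by simp
    show "\<forall>\<^sub>F t in at_top. - S t (\<bar>g\<bar> - k) = S t (k - \<bar>g\<bar>)"
      using eventually_ge_zero by eventually_elim (simp add: diff)
  qed
  ultimately have "k - \<bar>g\<bar> = 0" by (intro stable_nonneg_zero) simp_all
  with k(1) show ?thesis by simp
qed

lemma recurrent_inf:
  assumes "recurrent h" "recurrent k"
  shows "recurrent (inf h k)"
proof -
  have half: "(1 / 2) *\<^sub>R (a + a) = a" for a :: 'a
    by (simp flip: scaleR_2)
  have "inf h k = (1 / 2) *\<^sub>R (h + k - \<bar>h - k\<bar>)"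
  proof (rule antisym)
    have "\<bar>h - k\<bar> \<le> h + k - (inf h k + inf h k)"
    proof (rule abs_leI)
      have "inf h k + inf h k \<le> k + k" "inf h k + inf h k \<le> h + h" by (intro add_mono; simp)+
      then show "h - k \<le> h + k - (inf h k + inf h k)" "- (h - k) \<le> h + k - (inf h k + inf h k)"
        by (simp_all add: le_diff_eq diff_le_eq add.assoc add.left_commute)
    qed
    then have "inf h k + inf h k \<le> h + k - \<bar>h - k\<bar>"
      by (metis le_diff_eq add.commute)
    then have "(1 / 2) *\<^sub>R (inf h k + inf h k) \<le> (1 / 2) *\<^sub>R (h + k - \<bar>h - k\<bar>)"
      by (rule scaleR_left_mono) simp
    then show "inf h k \<le> (1 / 2) *\<^sub>R (h + k - \<bar>h - k\<bar>)" unfolding half .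
    have "h + k - \<bar>h - k\<bar> \<le> h + h"
      using abs_ge_minus_self[of "h - k"] by (simp add: algebra_simps)
    then have "(1 / 2) *\<^sub>R (h + k - \<bar>h - k\<bar>) \<le> (1 / 2) *\<^sub>R (h + h)"
      by (rule scaleR_left_mono) simp
    moreover have "h + k - \<bar>h - k\<bar> \<le> k + k"
      using abs_ge_self[of "h - k"] by (simp add: algebra_simps)
    then have "(1 / 2) *\<^sub>R (h + k - \<bar>h - k\<bar>) \<le> (1 / 2) *\<^sub>R (k + k)"
      by (rule scaleR_left_mono) simp
    ultimately show "(1 / 2) *\<^sub>R (h + k - \<bar>h - k\<bar>) \<le> inf h k"
      unfolding half by (rule inf_greatest)
  qed
  then show ?thesis
    using assms by (simp add: recurrent_scale recurrent_add recurrent_diff recurrent_abs)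
qed

text \<open>
  Here analyticity enters. If \<open>x\<close> is the recurrent preimage under \<open>S t\<close> of
  \<open>w = inf (S t h) k\<close>, then \<open>x \<le> h\<close> and \<open>w \<le> k\<close> are disjoint, so
  \<open>\<bar>S t x - x\<bar> = w + x\<close> dominates \<open>x\<close>, although its norm is at most half that of \<open>x\<close>.
\<close>

lemma disjoint_orbit:
  assumes h: "recurrent h" "0 \<le> h" and k: "recurrent k" "0 \<le> k" and hk: "inf h k = 0" and t: "0 \<le> t"
  shows "inf (S t h) k = 0"
proof -
  obtain \<tau> where \<tau>: "0 < \<tau>"
      "\<And>t x. 0 \<le> t \<Longrightarrow> t \<le> \<tau> \<Longrightarrow> recurrent x \<Longrightarrow> norm (S t x - x) \<le> norm x / 2"
    by (rule recurrent_small_increment) blast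
  \<comment> \<open>Stated for arbitrary \<open>h\<close>, so that the induction below can restart
    from each point of the orbit while \<open>k\<close> stays fixed.\<close>
  have step: "inf (S s h) k = 0"
    if s: "0 \<le> s" "s \<le> \<tau>" and h: "recurrent h" "0 \<le> h" and hk: "inf h k = 0" for s h
  proof -
    define w where "w = inf (S s h) k"
    have w: "recurrent w" "0 \<le> w" "w \<le> k" "w \<le> S s h"
      unfolding w_def using s h k
      by (simp_all add: recurrent_inf recurrent_orbit recurrent_nonneg_orbit)
    obtain x where x: "recurrent x" "S s x = w"
      using recurrent_preimage[OF w(1) s(1)] by metis
    have x0: "0 \<le> x" using recurrent_nonneg_cancel[OF x(1) s(1)] x(2) w(2) by simp
    have "0 \<le> S s (h - x)" using w(4) s(1) x(2) by (simp add: diff)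
    with recurrent_diff[OF h(1) x(1)] s(1) have "0 \<le> h - x" by (rule recurrent_nonneg_cancel)
    then have "inf w x \<le> inf k h" using w(3) by (intro inf_mono) simp_all
    then have "inf w x = 0"
      using hk w(2) x0 by (simp add: inf_commute antisym)
    have "x \<le> \<bar>S s x - x\<bar>"
    proof -
      have "x - inf w x \<le> \<bar>w - x\<bar>"
      proof -
        have "x - \<bar>w - x\<bar> \<le> w" using abs_ge_minus_self[of "w - x"] by (simp add: algebra_simps)
        moreover have "x - \<bar>w - x\<bar> \<le> x" by simp
        ultimately have "x - \<bar>w - x\<bar> \<le> inf w x" by simp
        then show ?thesis by (metis diff_le_eq add.commute)
      qed
      then show ?thesis using \<open>inf w x = 0\<close> x(2) by simp
    qed
    then have "norm x \<le> norm \<bar>S s x - x\<bar>" using x0 by (intro norm_mono_nonneg)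
    also have "\<dots> \<le> norm x / 2" using \<tau>(2)[OF s x(1)] by simp
    finally have "x = 0" by simp
    then show ?thesis using x(2) s(1) by (simp add: zero w_def)
  qed
  obtain n where n: "t / \<tau> \<le> real n" using real_arch_simple by blast
  \<comment> \<open>Using \<open>Suc n\<close> pieces keeps the divisor positive when
    \<open>n = 0\<close>; the choice of \<open>n\<close> makes each piece at most
    \<open>\<tau>\<close>.\<close>
  define s where "s = t / real (Suc n)"
  have s: "0 \<le> s" "s \<le> \<tau>" "t = real (Suc n) * s"
  proof -
    have "t \<le> real n * \<tau>" using n \<tau>(1) by (simp add: pos_divide_le_eq)
    also have "\<dots> \<le> real (Suc n) * \<tau>" using \<tau>(1) by simp
    finally show "s \<le> \<tau>" by (simp add: s_def pos_divide_le_eq mult.commute del: of_nat_Suc)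
  qed (use t in \<open>simp_all add: s_def\<close>)
  have "inf (S (real m * s) h) k = 0" for m
  proof (induction m)
    case 0
    then show ?case using hk by (simp add: at_zero)
  next
    case (Suc m)
    have m: "0 \<le> real m * s" using s by simp
    have "S (real (Suc m) * s) h = S s (S (real m * s) h)"
      using semigroup[OF s(1) m] by (simp add: algebra_simps)
    then show ?case
      using step[OF s(1,2) recurrent_orbit[OF h(1) m] recurrent_nonneg_orbit[OF h(1) m h(2)] Suc.IH] by simp
  qed
  then show ?thesis unfolding s(3) .
qed

text \<open>\<open>J\<close> is invariant by construction, since it asks for disjointness at all
  times from \<open>t0\<close> on, and it contains \<open>h\<close> by
  \<open>disjoint_orbit\<close>. If it were the whole space it would contain \<open>k\<close>, and
  return times of \<open>k\<close> would give \<open>inf k k = 0\<close>.\<close>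

lemma disjoint_recurrent:
  assumes h: "recurrent h" "0 \<le> h" and k: "recurrent k" "0 \<le> k" and hk: "inf h k = 0"
  shows "h = 0 \<or> k = 0"
proof -
  define J where "J = {f. \<forall>s\<ge>t0. inf (S s \<bar>f\<bar>) k = 0}"
  have memI: "y \<in> J" if "\<And>s. t0 \<le> s \<Longrightarrow> inf (S s \<bar>y\<bar>) k \<le> 0" for y
    unfolding J_def mem_Collect_eq
  proof (intro allI impI)
    fix s assume s: "t0 \<le> s"
    have "0 \<le> inf (S s \<bar>y\<bar>) k" using positive[OF s abs_ge_zero] k(2) by (rule inf_greatest)
    with that[OF s] show "inf (S s \<bar>y\<bar>) k = 0" by (rule antisym)
  qed
  have J: "y \<in> J" if "x \<in> J" "\<bar>y\<bar> \<le> \<bar>x\<bar>" for x y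
  proof (rule memI)
    fix s assume s: "t0 \<le> s"
    have "inf (S s \<bar>y\<bar>) k \<le> inf (S s \<bar>x\<bar>) k" using mono[OF s that(2)] by (rule inf_mono) simp
    also have "\<dots> = 0" using that(1) s unfolding J_def by blast
    finally show "inf (S s \<bar>y\<bar>) k \<le> 0" .
  qed
  have add_J: "x + y \<in> J" if "x \<in> J" "y \<in> J" for x y
  proof (rule memI)
    fix s assume s: "t0 \<le> s"
    have "inf (S s \<bar>x + y\<bar>) k \<le> inf (S s \<bar>x\<bar> + S s \<bar>y\<bar>) k"
      using mono[OF s abs_triangle_ineq[of x y]] s t0_nonneg by (intro inf_mono) (simp_all add: add)
    also have "\<dots> \<le> inf (S s \<bar>x\<bar>) k + inf (S s \<bar>y\<bar>) k"
      using s k(2) by (intro inf_add_le positive) simp_all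
    finally show "inf (S s \<bar>x + y\<bar>) k \<le> 0" using that s unfolding J_def by simp
  qed
  have sub: "subspace J"
    unfolding subspace_def
  proof (intro conjI ballI allI)
    show "0 \<in> J" using k(2) t0_nonneg by (intro memI) (simp add: zero)
  next
    fix c x assume x: "x \<in> J"
    \<comment> \<open>Membership survives sums, hence natural multiples, and any other multiple is
      dominated by one of these.\<close>
    have n: "real n *\<^sub>R x \<in> J" for n
    proof (induction n)
      case 0
      show ?case using J[OF x, of 0] by simp
    next
      case (Suc n)
      then show ?case using add_J[OF x Suc] by (simp add: algebra_simps)
    qed
    obtain n where "\<bar>c\<bar> \<le> real n" using real_arch_simple by blast
    then have "\<bar>c\<bar> *\<^sub>R \<bar>x\<bar> \<le> real n *\<^sub>R \<bar>x\<bar>" by (simp add: scaleR_right_mono)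
    moreover have "real n *\<^sub>R \<bar>x\<bar> \<le> \<bar>real n *\<^sub>R x\<bar>"
    proof (cases "n = 0")
      case False
      have "\<bar>x\<bar> \<le> \<bar>inverse (real n)\<bar> *\<^sub>R \<bar>real n *\<^sub>R x\<bar>"
        using abs_scaleR_le_abs[of "inverse (real n)" "real n *\<^sub>R x"] False by simp
      then have "real n *\<^sub>R \<bar>x\<bar> \<le> real n *\<^sub>R (\<bar>inverse (real n)\<bar> *\<^sub>R \<bar>real n *\<^sub>R x\<bar>)"
        by (rule scaleR_left_mono) simp
      then show ?thesis using False by simp
    qed simp
    ultimately show "c *\<^sub>R x \<in> J"
      using abs_scaleR_le_abs[of c x] by (intro J[OF n[of n]]) (rule order_trans, assumption, rule order_trans)
  qed (rule add_J)
  have clo: "closed J"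
    unfolding closed_sequential_limits
  proof (intro allI impI, elim conjE)
    fix X x assume X: "\<forall>n. X n \<in> J" and Xx: "X \<longlonglongrightarrow> x"
    show "x \<in> J"
    proof (rule memI)
      fix s assume s: "t0 \<le> s"
      have "(\<lambda>n. inf (S s \<bar>X n\<bar>) k) \<longlonglongrightarrow> inf (S s \<bar>x\<bar>) k"
        using Xx s t0_nonneg by (intro tendsto_inf_lattice tendsto tendsto_abs_lattice) simp_all
      moreover have "inf (S s \<bar>X n\<bar>) k = 0" for n using X s unfolding J_def by blast
      ultimately show "inf (S s \<bar>x\<bar>) k \<le> 0" by (simp add: LIMSEQ_const_iff)
    qed
  qed
  have inv: "S t x \<in> J" if t: "t0 \<le> t" and x: "x \<in> J" for t x
  proof (rule memI)
    fix s assume s: "t0 \<le> s"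
    have "S s \<bar>S t x\<bar> \<le> S s (S t \<bar>x\<bar>)" using s abs_le[OF t] by (rule mono)
    also have "\<dots> = S (s + t) \<bar>x\<bar>" using semigroup[of s t "\<bar>x\<bar>"] s t t0_nonneg by simp
    finally have "inf (S s \<bar>S t x\<bar>) k \<le> inf (S (s + t) \<bar>x\<bar>) k" by (rule inf_mono) simp
    also have "\<dots> = 0"
    proof -
      have "t0 \<le> s + t" using s t t0_nonneg by linarith
      then show ?thesis using x unfolding J_def by blast
    qed
    finally show "inf (S s \<bar>S t x\<bar>) k \<le> 0" .
  qed
  have "h \<in> J"
    using disjoint_orbit[OF h k hk] t0_nonneg h(2) unfolding J_def by simp
  have "k = 0" if "k \<in> J"
  proof -
    obtain s where s: "\<And>n. t0 \<le> s n" "(\<lambda>n. S (s n) k) \<longlonglongrightarrow> k"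
      using recurrent_pair_sequence[OF k(1) k(1), of t0] by metis
    have "(\<lambda>n. inf (S (s n) k) k) \<longlonglongrightarrow> inf k k" using s(2) by (rule tendsto_inf_lattice)
    moreover have "inf (S (s n) k) k = 0" for n
      using that s(1)[of n] k(2) unfolding J_def by simp
    ultimately show ?thesis by (simp add: LIMSEQ_const_iff)
  qed
  moreover have "J = {0} \<or> J = UNIV" using sub clo J inv by (rule irreducible)
  ultimately show ?thesis using \<open>h \<in> J\<close> by blast
qed

section \<open>Total order and one-dimensionality of the recurrent part\<close>

lemma recurrent_total:
  assumes "recurrent g"
  shows "0 \<le> g \<or> g \<le> 0"
proof -
  \<comment> \<open>The two vectors are twice the positive and twice the negative part of
    \<open>g\<close>, in a form whose recurrence is immediate from that of
    \<open>\<bar>g\<bar>\<close>.\<close>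
  have eq: "inf (\<bar>g\<bar> + g) (\<bar>g\<bar> - g) = 0"
  proof -
    have "inf (\<bar>g\<bar> + g) (\<bar>g\<bar> - g) = \<bar>g\<bar> + inf g (- g)"
      unfolding diff_conv_add_uminus by (rule add_inf_distrib_left[symmetric])
    also have "inf g (- g) = - \<bar>g\<bar>" by (simp add: abs_lattice inf_commute)
    finally show ?thesis by simp
  qed
  have "0 \<le> \<bar>g\<bar> + g" "0 \<le> \<bar>g\<bar> - g"
    using abs_ge_minus_self[of g] abs_ge_self[of g]
      diff_ge_0_iff_ge[of "\<bar>g\<bar>" "- g"] diff_ge_0_iff_ge[of "\<bar>g\<bar>" g]
    by (simp_all only: diff_minus_eq_add)
  then have "\<bar>g\<bar> + g = 0 \<or> \<bar>g\<bar> - g = 0"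
    using assms eq by (intro disjoint_recurrent recurrent_add recurrent_diff recurrent_abs)
  then show ?thesis
  proof
    assume "\<bar>g\<bar> + g = 0"
    then have "- g = \<bar>g\<bar>" by (simp add: add_eq_0_iff2)
    then have "0 \<le> - g" by (simp only: abs_ge_zero)
    then show ?thesis by simp
  next
    assume "\<bar>g\<bar> - g = 0"
    then have "g = \<bar>g\<bar>" by simp
    then have "0 \<le> g" by (metis abs_ge_zero)
    then show ?thesis ..
  qed
qed

text \<open>The scalars whose multiple of \<open>u\<close> lies below \<open>g\<close> and those
  whose multiple lies above it form two closed sets, which cover the real line by total order.
  Connectedness yields a common scalar.\<close>

lemma recurrent_span:
  assumes u: "recurrent u" "0 \<le> u" "u \<noteq> 0" and g: "recurrent g"
  shows "\<exists>c. g = c *\<^sub>R u"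
proof -
  define A where "A = {c. c *\<^sub>R u \<le> g}"
  define B where "B = {c. g \<le> c *\<^sub>R u}"
  \<comment> \<open>The positive cone is closed, so the order is Archimedean; this makes both sets
    nonempty.\<close>
  have no_bound: False if "\<And>n. real n *\<^sub>R u \<le> b" for b
  proof -
    have "u \<le> inverse (real (Suc n)) *\<^sub>R b" for n
      using scaleR_left_mono[OF that[of "Suc n"], of "inverse (real (Suc n))"] by simp
    moreover have "(\<lambda>n. inverse (real (Suc n)) *\<^sub>R b) \<longlonglongrightarrow> 0 *\<^sub>R b"
      by (intro tendsto_intros LIMSEQ_inverse_real_of_nat)
    ultimately have "u \<le> 0 *\<^sub>R b" by (rule LIMSEQ_le_lattice[OF tendsto_const, rotated])
    then have "u \<le> 0" by simp
    with u show False by simp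
  qed
  have AB: "A \<union> B = UNIV"
  proof -
    have "c \<in> A \<union> B" for c
      using recurrent_total[OF recurrent_diff[OF g recurrent_scale[OF u(1)]], of c]
      unfolding A_def B_def by simp
    then show ?thesis by blast
  qed
  have clA: "closed A"
    unfolding closed_sequential_limits A_def mem_Collect_eq
  proof (intro allI impI, elim conjE)
    fix X and c :: real assume X: "\<forall>n. X n *\<^sub>R u \<le> g" "X \<longlonglongrightarrow> c"
    show "c *\<^sub>R u \<le> g"
      by (rule LIMSEQ_le_lattice[OF tendsto_scaleR[OF X(2) tendsto_const] tendsto_const]) (use X(1) in blast)
  qed
  have clB: "closed B"
    unfolding closed_sequential_limits B_def mem_Collect_eq
  proof (intro allI impI, elim conjE)
    fix X and c :: real assume X: "\<forall>n. g \<le> X n *\<^sub>R u" "X \<longlonglongrightarrow> c"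
    show "g \<le> c *\<^sub>R u"
      by (rule LIMSEQ_le_lattice[OF tendsto_const tendsto_scaleR[OF X(2) tendsto_const]]) (use X(1) in blast)
  qed
  have "A \<noteq> {}"
  proof
    assume "A = {}"
    then have "- real n \<in> B" for n using AB by blast
    then have "real n *\<^sub>R u \<le> - g" for n
      unfolding B_def by (metis mem_Collect_eq neg_le_iff_le minus_minus scaleR_minus_left)
    then show False by (rule no_bound)
  qed
  moreover have "B \<noteq> {}"
  proof
    assume "B = {}"
    then have "real n \<in> A" for n using AB by blast
    then have "real n *\<^sub>R u \<le> g" for n unfolding A_def by blast
    then show False by (rule no_bound)
  qed
  ultimately have "A \<inter> B \<noteq> {}"
    using connected_UNIV[where 'a = real] clA clB AB unfolding connected_closed by auto
  then obtain c where "c \<in> A" "c \<in> B" by blast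
  then show ?thesis unfolding A_def B_def by (auto intro: antisym)
qed

text \<open>On the line through \<open>u\<close> the operator is multiplication by some
  \<open>c \<ge> 0\<close> whose powers are trapped between \<open>1 / M\<close> and
  \<open>M\<close>: above by boundedness, below by \<open>recurrent_lower_bound\<close>. Only
  \<open>c = 1\<close> allows this.\<close>

lemma recurrent_fixed:
  assumes u: "recurrent u" "0 \<le> u" "u \<noteq> 0" and t: "0 \<le> t"
  shows "S t u = u"
proof -
  obtain c where c: "S t u = c *\<^sub>R u"
    using recurrent_span[OF u recurrent_orbit[OF u(1) t]] by blast
  have nu: "0 < norm u" using u(3) by simp
  have pow: "S (real n * t) u = c ^ n *\<^sub>R u" for n
  proof (induction n)
    case 0
    then show ?case by (simp add: at_zero)
  next
    case (Suc n)
    have "S (real (Suc n) * t) u = S t (S (real n * t) u)"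
      using semigroup[of t "real n * t" u] t by (simp add: algebra_simps)
    then show ?case using Suc t c by (simp add: scale mult.commute)
  qed
  have c0: "0 \<le> c"
  proof (rule ccontr)
    assume "\<not> 0 \<le> c"
    moreover have "0 \<le> c *\<^sub>R u" using recurrent_nonneg_orbit[OF u(1) t u(2)] c by simp
    ultimately have "c *\<^sub>R u = 0"
      using scaleR_nonpos_nonneg[of c u] u(2) by (intro antisym) simp_all
    then show False using u(3) \<open>\<not> 0 \<le> c\<close> by simp
  qed
  have up: "c ^ n \<le> M" for n
  proof -
    have "norm (c ^ n *\<^sub>R u) \<le> M * norm u" unfolding pow[symmetric] using t by (intro bounded) simp
    then show ?thesis using nu c0 by simp
  qed
  have lo: "1 \<le> M * c ^ n" for n
  proof -
    have "norm u \<le> M * norm (c ^ n *\<^sub>R u)"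
      unfolding pow[symmetric] using t by (intro recurrent_lower_bound u) simp
    then have "1 * norm u \<le> (M * c ^ n) * norm u" using c0 by (simp add: mult.assoc)
    then show ?thesis using nu mult_le_cancel_right_pos[OF nu] by blast
  qed
  have "c \<le> 1" using up real_arch_pow[of c M] by (meson leI not_less)
  moreover have "\<not> c < 1"
  proof
    assume "c < 1"
    then obtain n where "c ^ n < inverse M" using real_arch_pow_inv[of "inverse M" c] M_pos by auto
    then have "M * c ^ n < 1" using M_pos by (simp add: field_simps)
    with lo[of n] show False by simp
  qed
  ultimately show ?thesis using c by simp
qed

text \<open>The real form of quasi-interiority. The ideal is invariant because
  \<open>S t u = u\<close> bounds \<open>\<bar>S t x\<bar> - c u\<close> by
  \<open>S t (\<bar>x\<bar> - c u)\<close>. As it contains \<open>u \<noteq> 0\<close>,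
  irreducibility makes it everything.\<close>

lemma fixed_vector_ideal_dense:
  assumes u: "0 \<le> u" "u \<noteq> 0" and fix_u: "\<And>t. 0 \<le> t \<Longrightarrow> S t u = u" and e: "0 < e"
  shows "\<exists>y c. 0 < c \<and> \<bar>y\<bar> \<le> c *\<^sub>R u \<and> norm (x - y) < e"
proof -
  \<comment> \<open>For \<open>c \<ge> 0\<close> the norm of \<open>excess c x\<close> is the
    distance of \<open>x\<close> from the order interval between \<open>- c u\<close> and
    \<open>c u\<close>.\<close>
  define excess where "excess c x = pprt (\<bar>x\<bar> - c *\<^sub>R u)" for c :: real and x
  \<comment> \<open>\<open>J\<close> is the closure of the principal ideal of \<open>u\<close>, in a form that is visibly an ideal.\<close>
  define J where "J = {x. \<forall>e>0. \<exists>c>0. norm (excess c x) < e}"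
  have ex0: "0 \<le> excess c x" for c x by (simp add: excess_def)
  have ex_leI: "excess c x \<le> b" if "\<bar>x\<bar> - c *\<^sub>R u \<le> b" "0 \<le> b" for c x b
    using that by (simp add: excess_def pprt_def)
  have ex_ge: "\<bar>x\<bar> - c *\<^sub>R u \<le> excess c x" for c x by (simp add: excess_def pprt_def)
  have J: "y \<in> J" if x: "x \<in> J" and yx: "\<bar>y\<bar> \<le> \<bar>x\<bar>" for x y
    unfolding J_def mem_Collect_eq
  proof (intro allI impI)
    fix e :: real assume "0 < e"
    with x obtain c where c: "0 < c" "norm (excess c x) < e" unfolding J_def by blast
    have "excess c y \<le> excess c x"
      using yx ex_ge[of x c] ex0 by (intro ex_leI) (meson diff_right_mono order_trans)
    then have "norm (excess c y) \<le> norm (excess c x)" using ex0 by (intro norm_mono_nonneg)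
    with c show "\<exists>c>0. norm (excess c y) < e" by (auto intro: le_less_trans)
  qed
  have add_J: "x + y \<in> J" if x: "x \<in> J" and y: "y \<in> J" for x y
    unfolding J_def mem_Collect_eq
  proof (intro allI impI)
    fix e :: real assume "0 < e"
    then have "0 < e / 2" by simp
    then obtain c d where c: "0 < c" "norm (excess c x) < e / 2" and d: "0 < d" "norm (excess d y) < e / 2"
      using x y unfolding J_def by blast
    have "excess (c + d) (x + y) \<le> excess c x + excess d y"
    proof (rule ex_leI)
      have "\<bar>x + y\<bar> - (c + d) *\<^sub>R u \<le> (\<bar>x\<bar> + \<bar>y\<bar>) - (c + d) *\<^sub>R u"
        using abs_triangle_ineq[of x y] by (rule diff_right_mono)
      also have "\<dots> = (\<bar>x\<bar> - c *\<^sub>R u) + (\<bar>y\<bar> - d *\<^sub>R u)" by (simp add: algebra_simps)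
      also have "\<dots> \<le> excess c x + excess d y" by (intro add_mono ex_ge)
      finally show "\<bar>x + y\<bar> - (c + d) *\<^sub>R u \<le> excess c x + excess d y" .
    qed (intro add_nonneg_nonneg ex0)
    then have "norm (excess (c + d) (x + y)) \<le> norm (excess c x + excess d y)"
      using ex0 by (intro norm_mono_nonneg)
    also have "\<dots> < e" using norm_triangle_ineq[of "excess c x" "excess d y"] c d by linarith
    finally show "\<exists>c>0. norm (excess c (x + y)) < e" using c d by (intro exI[of _ "c + d"]) simp
  qed
  have sub: "subspace J"
    unfolding subspace_def
  proof (intro conjI ballI allI)
    have "excess 1 0 = 0" using u(1) ex0[of 1 0] by (intro antisym ex_leI) simp_all
    then have "norm (excess 1 0) < e" if "0 < e" for e using that by simp
    then show "0 \<in> J" unfolding J_def using zero_less_one by blast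
  next
    fix r x assume x: "x \<in> J"
    show "r *\<^sub>R x \<in> J"
      unfolding J_def mem_Collect_eq
    proof (intro allI impI)
      fix e :: real assume e: "0 < e"
      \<comment> \<open>The added 1 keeps \<open>a\<close> positive when \<open>r = 0\<close>, as
        the tolerance \<open>e / a\<close> and the witness \<open>a * c\<close> require.\<close>
      define a where "a = \<bar>r\<bar> + 1"
      have a: "0 < a" "\<bar>r\<bar> \<le> a" by (simp_all add: a_def)
      then have "0 < e / a" using e by simp
      then obtain c where c: "0 < c" "norm (excess c x) < e / a" using x unfolding J_def by blast
      have "excess (a * c) (r *\<^sub>R x) \<le> a *\<^sub>R excess c x"
      proof (rule ex_leI)
        have "\<bar>r *\<^sub>R x\<bar> - (a * c) *\<^sub>R u \<le> a *\<^sub>R \<bar>x\<bar> - (a * c) *\<^sub>R u"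
          using order_trans[OF abs_scaleR_le_abs scaleR_right_mono[OF a(2) abs_ge_zero]]
          by (rule diff_right_mono)
        also have "\<dots> = a *\<^sub>R (\<bar>x\<bar> - c *\<^sub>R u)" by (simp add: algebra_simps)
        also have "\<dots> \<le> a *\<^sub>R excess c x" using a by (intro scaleR_left_mono ex_ge) simp
        finally show "\<bar>r *\<^sub>R x\<bar> - (a * c) *\<^sub>R u \<le> a *\<^sub>R excess c x" .
      qed (use a ex0 in \<open>simp add: scaleR_nonneg_nonneg\<close>)
      then have "norm (excess (a * c) (r *\<^sub>R x)) \<le> norm (a *\<^sub>R excess c x)"
        using ex0 by (intro norm_mono_nonneg)
      also have "\<dots> < e" using a c by (simp add: field_simps)
      finally show "\<exists>c>0. norm (excess c (r *\<^sub>R x)) < e"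
        using a c by (intro exI[of _ "a * c"]) simp
    qed
  qed (rule add_J)
  have clo: "closed J"
    unfolding closed_sequential_limits
  proof (intro allI impI, elim conjE)
    fix X x assume X: "\<forall>n. X n \<in> J" and Xx: "X \<longlonglongrightarrow> x"
    show "x \<in> J"
      unfolding J_def mem_Collect_eq
    proof (intro allI impI)
      fix e :: real assume "0 < e"
      then have e: "0 < e / 2" by simp
      then obtain n where n: "norm (X n - x) < e / 2" using LIMSEQ_D[OF Xx] by blast
      obtain c where c: "0 < c" "norm (excess c (X n)) < e / 2"
        using X e unfolding J_def by blast
      have "excess c x \<le> \<bar>X n - x\<bar> + excess c (X n)"
      proof (rule ex_leI)
        have "\<bar>x\<bar> \<le> \<bar>X n - x\<bar> + \<bar>X n\<bar>"
          using abs_triangle_ineq2[of x "X n"] by (metis abs_minus_commute diff_le_eq)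
        then have "\<bar>x\<bar> - c *\<^sub>R u \<le> \<bar>X n - x\<bar> + (\<bar>X n\<bar> - c *\<^sub>R u)"
          by (metis add_diff_eq diff_right_mono)
        also have "\<dots> \<le> \<bar>X n - x\<bar> + excess c (X n)" by (intro add_left_mono ex_ge)
        finally show "\<bar>x\<bar> - c *\<^sub>R u \<le> \<bar>X n - x\<bar> + excess c (X n)" .
      qed (intro add_nonneg_nonneg ex0 abs_ge_zero)
      then have "norm (excess c x) \<le> norm (\<bar>X n - x\<bar> + excess c (X n))"
        using ex0 by (intro norm_mono_nonneg)
      also have "\<dots> < e"
        using norm_triangle_ineq[of "\<bar>X n - x\<bar>" "excess c (X n)"] n c by simp
      finally show "\<exists>c>0. norm (excess c x) < e" using c by blast
    qed
  qed
  have inv: "S t x \<in> J" if t: "t0 \<le> t" and x: "x \<in> J" for t x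
    unfolding J_def mem_Collect_eq
  proof (intro allI impI)
    fix e :: real assume "0 < e"
    then have "0 < e / M" using M_pos by simp
    then obtain c where c: "0 < c" "norm (excess c x) < e / M" using x unfolding J_def by blast
    have t': "0 \<le> t" using t t0_nonneg by simp
    have "excess c (S t x) \<le> S t (excess c x)"
    proof (rule ex_leI)
      have "\<bar>S t x\<bar> - c *\<^sub>R u \<le> S t \<bar>x\<bar> - c *\<^sub>R u" using abs_le[OF t] by (rule diff_right_mono)
      also have "\<dots> = S t (\<bar>x\<bar> - c *\<^sub>R u)" using t' by (simp add: diff scale fix_u)
      also have "\<dots> \<le> S t (excess c x)" using t ex_ge by (rule mono)
      finally show "\<bar>S t x\<bar> - c *\<^sub>R u \<le> S t (excess c x)" .
    qed (rule positive[OF t ex0])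
    then have "norm (excess c (S t x)) \<le> norm (S t (excess c x))" using ex0 by (intro norm_mono_nonneg)
    also have "\<dots> \<le> M * norm (excess c x)" using t' by (rule bounded)
    also have "\<dots> < e" using c M_pos by (simp add: field_simps)
    finally show "\<exists>c>0. norm (excess c (S t x)) < e" using c by blast
  qed
  have "excess 1 u = 0" using u(1) ex0[of 1 u] by (intro antisym ex_leI) simp_all
  then have "norm (excess 1 u) < e" if "0 < e" for e using that by simp
  then have "u \<in> J" unfolding J_def using zero_less_one by blast
  moreover have "J = {0} \<or> J = UNIV" using sub clo J inv by (rule irreducible)
  ultimately have J_UNIV: "J = UNIV" using u(2) by blast
  \<comment> \<open>For positive \<open>a\<close> the vector \<open>a - excess c a\<close> is the
    truncation \<open>inf a (c u)\<close>. General vectors are split into positive and negative part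
    afterwards.\<close>
  have approx: "\<exists>y c. 0 < c \<and> \<bar>y\<bar> \<le> c *\<^sub>R u \<and> norm (a - y) < e" if a: "0 \<le> a" and e: "0 < e" for a e
  proof -
    have "a \<in> J" using J_UNIV by simp
    then obtain c where c: "0 < c" "norm (excess c a) < e" using e unfolding J_def by blast
    have "excess c a \<le> a"
    proof (rule ex_leI)
      have "0 \<le> c *\<^sub>R u" using c(1) u(1) by (simp add: scaleR_nonneg_nonneg)
      then show "\<bar>a\<bar> - c *\<^sub>R u \<le> a" using a by (simp add: diff_le_eq)
    qed (rule a)
    moreover have "a - excess c a \<le> c *\<^sub>R u"
      using ex_ge[of a c] a by (simp add: algebra_simps)
    ultimately have "\<bar>a - excess c a\<bar> \<le> c *\<^sub>R u" by simp
    then show ?thesis using c by (intro exI[of _ "a - excess c a"] exI[of _ c]) simp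
  qed
  obtain y c where y: "0 < c" "\<bar>y\<bar> \<le> c *\<^sub>R u" "norm (pprt x - y) < e / 2"
    using approx[of "pprt x" "e / 2"] e by auto
  obtain z d where z: "0 < d" "\<bar>z\<bar> \<le> d *\<^sub>R u" "norm (pprt (- x) - z) < e / 2"
    using approx[of "pprt (- x)" "e / 2"] e by auto
  have "\<bar>y - z\<bar> \<le> (c + d) *\<^sub>R u"
    using order_trans[OF abs_triangle_ineq4 add_mono[OF y(2) z(2)]] by (simp add: scaleR_left_distrib)
  moreover have "norm (x - (y - z)) < e"
  proof -
    have "x = pprt x - pprt (- x)" using prts[of x] by (simp add: pprt_neg)
    then have "x - (y - z) = (pprt x - y) - (pprt (- x) - z)" by (simp add: algebra_simps)
    then have "norm (x - (y - z)) \<le> norm (pprt x - y) + norm (pprt (- x) - z)"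
      by (metis norm_triangle_ineq4)
    then show ?thesis using y(3) z(3) by linarith
  qed
  ultimately show ?thesis using y(1) z(1) by (intro exI[of _ "y - z"] exI[of _ "c + d"]) simp
qed

text \<open>\<open>\<phi> x\<close> is the coefficient with respect to \<open>u\<close> of the
  recurrent part of \<open>x\<close>. It cannot vanish for positive \<open>x \<noteq> 0\<close>,
  since \<open>x\<close> would then be stable. Linearity and invariance follow from uniqueness of
  limits.\<close>

lemma rank_one_limit:
  obtains u \<phi> where "0 \<le> u" "u \<noteq> 0" "\<And>t. 0 \<le> t \<Longrightarrow> S t u = u"
    "\<And>x. ((\<lambda>t. S t x) \<longlongrightarrow> \<phi> x *\<^sub>R u) at_top"
    "\<And>x. 0 \<le> x \<Longrightarrow> x \<noteq> 0 \<Longrightarrow> 0 < \<phi> x"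
    "bounded_linear (\<phi> :: 'a \<Rightarrow> real)" "\<phi> u = 1" "\<And>t x. 0 \<le> t \<Longrightarrow> \<phi> (S t x) = \<phi> x"
proof -
  obtain x where x: "\<not> ((\<lambda>t. S t x) \<longlongrightarrow> 0) at_top" using nonvanishing by blast
  obtain k where k: "recurrent k" "((\<lambda>t. S t (x - k)) \<longlongrightarrow> 0) at_top"
    by (rule recurrent_decomposition)
  define u where "u = \<bar>k\<bar>"
  have u: "recurrent u" "0 \<le> u" unfolding u_def using recurrent_abs[OF k(1)] by simp_all
  have u0: "u \<noteq> 0" using k x by (auto simp: u_def)
  have fix_u: "S t u = u" if "0 \<le> t" for t using u u0 that by (rule recurrent_fixed)
  have "\<exists>c. ((\<lambda>t. S t x) \<longlongrightarrow> c *\<^sub>R u) at_top" for x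
  proof -
    obtain k where k: "recurrent k" "((\<lambda>t. S t (x - k)) \<longlongrightarrow> 0) at_top"
      by (rule recurrent_decomposition)
    obtain c where c: "k = c *\<^sub>R u" using recurrent_span[OF u u0 k(1)] by blast
    have "((\<lambda>t. S t x) \<longlongrightarrow> c *\<^sub>R u) at_top"
    proof (rule Lim_transform_eventually)
      show "((\<lambda>t. S t (x - k) + c *\<^sub>R u) \<longlongrightarrow> c *\<^sub>R u) at_top"
        using tendsto_add[OF k(2) tendsto_const[of "c *\<^sub>R u"]] by simp
      show "\<forall>\<^sub>F t in at_top. S t (x - k) + c *\<^sub>R u = S t x"
        using eventually_ge_zero by eventually_elim (simp add: c diff scale fix_u)
    qed
    then show ?thesis by blast
  qed
  then obtain \<phi> where \<phi>: "\<And>x. ((\<lambda>t. S t x) \<longlongrightarrow> \<phi> x *\<^sub>R u) at_top" by metis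
  have "0 < \<phi> x" if "0 \<le> x" "x \<noteq> 0" for x
  proof -
    have "filterlim (\<lambda>n. t0 + real n) at_top sequentially"
      by (intro filterlim_tendsto_add_at_top[OF tendsto_const] filterlim_real_sequentially)
    then have lim: "(\<lambda>n. S (t0 + real n) x) \<longlonglongrightarrow> \<phi> x *\<^sub>R u"
      by (rule filterlim_compose[OF \<phi>])
    have "0 \<le> S (t0 + real n) x" for n using that(1) by (intro positive) simp_all
    with lim have pos: "0 \<le> \<phi> x *\<^sub>R u" by (rule LIMSEQ_nonneg_lattice)
    have "\<phi> x \<noteq> 0" using stable_nonneg_zero[OF that(1)] \<phi>[of x] that(2) by auto
    moreover have "\<not> \<phi> x < 0"
    proof
      assume neg: "\<phi> x < 0"
      then have "\<phi> x *\<^sub>R u = 0"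
        using scaleR_nonpos_nonneg[of "\<phi> x" u] u(2) pos by (intro antisym) simp_all
      then show False using neg u0 by simp
    qed
    ultimately show ?thesis by simp
  qed
  moreover have eqI: "\<phi> x = c" if "((\<lambda>t. S t x) \<longlongrightarrow> c *\<^sub>R u) at_top" for x c
    using tendsto_unique[OF _ that \<phi>] u0 by simp
  moreover have "bounded_linear \<phi>"
  proof (rule bounded_linear_intro)
    fix x y c
    have "((\<lambda>t. S t x + S t y) \<longlongrightarrow> (\<phi> x + \<phi> y) *\<^sub>R u) at_top"
      unfolding scaleR_left_distrib by (intro tendsto_add \<phi>)
    moreover have "\<forall>\<^sub>F t in at_top. S t x + S t y = S t (x + y)"
      using eventually_ge_zero by eventually_elim (simp add: add)
    ultimately show "\<phi> (x + y) = \<phi> x + \<phi> y" by (intro eqI) (rule Lim_transform_eventually)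
    have "((\<lambda>t. c *\<^sub>R S t x) \<longlongrightarrow> (c * \<phi> x) *\<^sub>R u) at_top"
      using tendsto_scaleR[OF tendsto_const \<phi>, of c x] by simp
    moreover have "\<forall>\<^sub>F t in at_top. c *\<^sub>R S t x = S t (c *\<^sub>R x)"
      using eventually_ge_zero by eventually_elim (simp add: scale)
    ultimately show "\<phi> (c *\<^sub>R x) = c *\<^sub>R \<phi> x"
      unfolding real_scaleR_def by (intro eqI) (rule Lim_transform_eventually)
    have "norm (\<phi> x *\<^sub>R u) \<le> M * norm x"
    proof (rule tendsto_upperbound[OF tendsto_norm[OF \<phi>]])
      show "\<forall>\<^sub>F t in at_top. norm (S t x) \<le> M * norm x"
        using eventually_ge_zero by eventually_elim (rule bounded)
    qed simp
    then show "norm (\<phi> x) \<le> norm x * (M / norm u)"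
      using u0 by (simp add: field_simps)
  qed
  moreover have "\<phi> u = 1"
  proof (intro eqI tendsto_eventually)
    show "\<forall>\<^sub>F t in at_top. S t u = 1 *\<^sub>R u"
      using eventually_ge_zero by eventually_elim (simp add: fix_u)
  qed
  moreover have "\<phi> (S t x) = \<phi> x" if t: "0 \<le> t" for t x
  proof (rule eqI)
    have "((\<lambda>s. S t (S s x)) \<longlongrightarrow> S t (\<phi> x *\<^sub>R u)) at_top" using t \<phi> by (rule tendsto)
    moreover have "\<forall>\<^sub>F s in at_top. S t (S s x) = S s (S t x)"
      using eventually_ge_zero by eventually_elim (use t in \<open>simp add: commute\<close>)
    ultimately have "((\<lambda>s. S s (S t x)) \<longlongrightarrow> S t (\<phi> x *\<^sub>R u)) at_top"
      by (rule Lim_transform_eventually)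
    then show "((\<lambda>s. S s (S t x)) \<longlongrightarrow> \<phi> x *\<^sub>R u) at_top" using t by (simp add: scale fix_u)
  qed
  ultimately show thesis using u(2) u0 fix_u \<phi> by (intro that) 
qed

end

section \<open>Passage to the complexification\<close>

text \<open>For a real semigroup \<open>re_part\<close> discards nothing here, because real vectors
  stay real.\<close>

definition real_restriction ::
    "(real \<Rightarrow> 'a :: banach_lattice complexification \<Rightarrow> 'a complexification) \<Rightarrow> real \<Rightarrow> 'a \<Rightarrow> 'a"
  where "real_restriction T t x = re_part (T t (of_real_part x))"

lemma of_real_part_simps [simp]:
  "re_part (of_real_part x) = (x :: 'a :: banach_lattice)" "im_part (of_real_part x) = (0 :: 'a)"
  by (simp_all add: of_real_part_def)

lemma norm_of_real_part [simp]: "norm (of_real_part x) = norm x"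
  by (simp add: norm_complexification_def)

lemma bounded_linear_re_part: "bounded_linear re_part"
  by (rule bounded_linear_intro[where K = 1]) (simp_all add: norm_re_part_le)

lemma bounded_linear_im_part: "bounded_linear im_part"
  by (rule bounded_linear_intro[where K = 1]) (simp_all add: norm_im_part_le)

lemma bounded_linear_of_real_part: "bounded_linear of_real_part"
  by (rule bounded_linear_intro[where K = 1]) (simp_all add: complexification_eq_iff)

lemma tendsto_complexification:
  assumes "((\<lambda>x. re_part (f x)) \<longlongrightarrow> re_part l) F" "((\<lambda>x. im_part (f x)) \<longlongrightarrow> im_part l) F"
  shows "(f \<longlongrightarrow> l) F"
proof -
  have "((\<lambda>x. f x - l) \<longlongrightarrow> 0) F"
  proof (rule Lim_null_comparison)
    show "\<forall>\<^sub>F x in F. norm (f x - l) \<le> norm (re_part (f x) - re_part l) + norm (im_part (f x) - im_part l)"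
      using norm_complexification_le[of "f _ - l"] by simp
    show "((\<lambda>x. norm (re_part (f x) - re_part l) + norm (im_part (f x) - im_part l)) \<longlongrightarrow> 0) F"
      using tendsto_add[OF tendsto_norm_zero[OF LIM_zero[OF assms(1)]] tendsto_norm_zero[OF LIM_zero[OF assms(2)]]]
      by simp
  qed
  then show ?thesis by (rule LIM_zero_cancel)
qed

lemma real_operator_parts:
  assumes B: "bounded_operator B" and real: "real_operator B"
  shows "re_part (B f) = re_part (B (of_real_part (re_part f)))"
    and "im_part (B f) = re_part (B (of_real_part (im_part f)))"
proof -
  have im0: "im_part (B (of_real_part x)) = 0" for x
  proof -
    have "B (of_real_part x) \<in> real_part_space"
      using real unfolding real_operator_def real_part_space_def by blast
    then show ?thesis by (auto simp: real_part_space_def)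
  qed
  have "f = of_real_part (re_part f) + \<i> *\<^sub>C of_real_part (im_part f)"
    by (simp add: scaleC_def complexification_eq_iff)
  then have "B f = B (of_real_part (re_part f) + \<i> *\<^sub>C of_real_part (im_part f))" by simp
  also have "\<dots> = B (of_real_part (re_part f)) + \<i> *\<^sub>C B (of_real_part (im_part f))"
    using B by (simp add: bounded_operator_def linear_simps(1))
  finally show "re_part (B f) = re_part (B (of_real_part (re_part f)))"
    "im_part (B f) = re_part (B (of_real_part (im_part f)))"
    by (simp_all add: scaleC_def im0)
qed

text \<open>Near the point 1 the difference quotient is within 1 of the derivative \<open>D\<close>
  in operator norm, hence bounded by \<open>C\<close>; the increment is then at most
  \<open>t * C\<close>.\<close>

lemma analytic_increment_bound:
  assumes "analytic_semigroup T" and T: "\<And>t. 0 \<le> t \<Longrightarrow> bounded_operator (T t)" and e: "0 < e"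
  shows "\<exists>\<tau>>0. \<forall>t\<in>{0..\<tau>}. \<forall>f. norm (T (1 + t) f - T 1 f) \<le> e * norm f"
proof -
  obtain \<delta> S where \<delta>: "0 < \<delta>" and S: "\<forall>t\<ge>0. S (complex_of_real t) = T t"
    and an: "operator_analytic_on S (sector \<delta>)"
    using assms(1) unfolding analytic_semigroup_def by blast
  have "1 \<in> sector \<delta>" using \<delta> by (simp add: sector_def Arg_of_real)
  then obtain D where D: "bounded_operator D"
      "((\<lambda>w. onorm (\<lambda>f. inverse (w - 1) *\<^sub>C (S w f - S 1 f) - D f)) \<longlongrightarrow> 0) (at 1)"
    using an unfolding operator_analytic_on_def by blast
  have "\<forall>\<^sub>F w in at 1. onorm (\<lambda>f. inverse (w - 1) *\<^sub>C (S w f - S 1 f) - D f) < 1"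
    using D(2) by (rule order_tendstoD) simp
  then obtain d where d: "0 < d"
      "\<And>w. w \<noteq> 1 \<Longrightarrow> dist w 1 < d \<Longrightarrow> onorm (\<lambda>f. inverse (w - 1) *\<^sub>C (S w f - S 1 f) - D f) < 1"
    unfolding eventually_at by blast
  define C where "C = 1 + onorm D"
  have D_lin: "bounded_linear D" using D(1) by (simp add: bounded_operator_def)
  then have C: "0 < C" using onorm_pos_le[OF D_lin] by (simp add: C_def)
  have bound: "norm (T (1 + t) f - T 1 f) \<le> t * C * norm f" if t: "0 < t" "t < d" for t f
  proof -
    define w where "w = complex_of_real (1 + t)"
    define G where "G = (\<lambda>f. inverse t *\<^sub>R (T (1 + t) f - T 1 f) - D f)"
    have w: "w \<noteq> 1" "dist w 1 < d" "w - 1 = of_real t" using t by (auto simp: w_def dist_norm)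
    have Sw: "S w = T (1 + t)" "S 1 = T 1"
      using S[rule_format, of "1 + t"] S[rule_format, of 1] t by (simp_all add: w_def)
    have "inverse (w - 1) *\<^sub>C (S w f - S 1 f) - D f = G f" for f
      unfolding w(3) Sw G_def of_real_inverse[symmetric] scaleC_of_real ..
    then have less: "onorm G < 1" using d(2)[OF w(1,2)] by simp
    have lin: "bounded_linear (T (1 + t))" "bounded_linear (T 1)"
      using T[of "1 + t"] T[of 1] t by (auto simp: bounded_operator_def)
    have "bounded_linear G"
      unfolding G_def
      by (intro bounded_linear_sub bounded_linear_compose[OF bounded_linear_scaleR_right] lin D_lin)
    then have "norm (G f) \<le> onorm G * norm f" by (rule onorm)
    also have "\<dots> \<le> 1 * norm f" using less by (intro mult_right_mono) simp_all
    finally have G: "norm (G f) \<le> norm f" by simp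
    have "T (1 + t) f - T 1 f = t *\<^sub>R (G f + D f)" using t by (simp add: G_def)
    then have "norm (T (1 + t) f - T 1 f) = t * norm (G f + D f)" using t by simp
    also have "norm (G f + D f) \<le> C * norm f"
      using norm_triangle_ineq[of "G f" "D f"] G onorm[OF D_lin, of f] by (simp add: C_def algebra_simps)
    finally show ?thesis using t by (simp add: mult.assoc mult_left_mono)
  qed
  \<comment> \<open>Half of \<open>d\<close> keeps \<open>1 + t\<close> strictly inside the
    neighbourhood of 1, and \<open>e / C\<close> brings \<open>t * C\<close> below
    \<open>e\<close>.\<close>
  define \<tau> where "\<tau> = min (d / 2) (e / C)"
  show ?thesis
  proof (intro exI[of _ \<tau>] conjI ballI allI)
    show "0 < \<tau>" using d(1) e C by (simp add: \<tau>_def)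
    fix t f assume t: "t \<in> {0..\<tau>}"
    show "norm (T (1 + t) f - T 1 f) \<le> e * norm f"
    proof (cases "t = 0")
      case True
      then show ?thesis using e by simp
    next
      case False
      then have "0 < t" "t < d" "t * C \<le> e" using t d(1) C by (auto simp: \<tau>_def field_simps)
      then show ?thesis
        using bound[of t f] mult_right_mono[of "t * C" e "norm f"] by simp
    qed
  qed
qed

text \<open>\<open>M\<close> comes from \<open>uniform_boundedness\<close>, as relatively compact
  orbits are bounded. Irreducibility descends because an invariant ideal of the real space has an
  invariant complexification.\<close>

lemma real_restriction_locale:
  fixes T :: "real \<Rightarrow> 'a :: banach_lattice complexification \<Rightarrow> 'a complexification"
  assumes C0: "C0_semigroup T" and real: "real_semigroup T" and analytic: "analytic_semigroup T"
    and pos: "uniformly_eventually_positive T" and irr: "persistently_irreducible T"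
    and cpt: "relatively_compact_orbits T"
  obtains t0 M where "compact_positive_semigroup (real_restriction T) t0 M"
proof -
  let ?R = "real_restriction T"
  have op: "bounded_operator (T t)" if "0 \<le> t" for t using C0 that by (simp add: C0_semigroup_def)
  have ro: "real_operator (T t)" if "0 \<le> t" for t using real that by (simp add: real_semigroup_def)
  have re: "re_part (T t f) = ?R t (re_part f)" and im: "im_part (T t f) = ?R t (im_part f)" if "0 \<le> t" for t f
    unfolding real_restriction_def
    by (rule real_operator_parts[OF op[OF that] ro[OF that]])+
  have lin: "bounded_linear (T t)" if "0 \<le> t" for t using op[OF that] by (simp add: bounded_operator_def)
  have R_lin: "bounded_linear (?R t)" if "0 \<le> t" for t
    unfolding real_restriction_def
    by (intro bounded_linear_compose[OF bounded_linear_re_part] bounded_linear_compose[OF lin[OF that]]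
        bounded_linear_of_real_part)
  have R_bounded: "\<exists>B. \<forall>t\<in>{0..}. norm (?R t x) \<le> B" for x
  proof -
    have "bounded ((\<lambda>t. T t (of_real_part x)) ` {0..})"
      using cpt unfolding relatively_compact_orbits_def
      by (meson bounded_subset closure_subset compact_imp_bounded)
    then obtain B where "\<forall>t\<in>{0..}. norm (T t (of_real_part x)) \<le> B" unfolding bounded_iff by auto
    then show ?thesis
      unfolding real_restriction_def using norm_re_part_le order_trans by blast
  qed
  obtain M where M: "1 \<le> M" "\<And>t x. t \<in> {0..} \<Longrightarrow> norm (?R t x) \<le> M * norm x"
    by (rule uniform_boundedness[of "{0..}" ?R]) (use R_lin R_bounded in auto)
  obtain t0 where t0: "0 \<le> t0" "\<And>t f. t0 \<le> t \<Longrightarrow> 0 \<le> f \<Longrightarrow> 0 \<le> T t f"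
    using pos unfolding uniformly_eventually_positive_def by blast
  have "compact_positive_semigroup ?R t0 M"
  proof (rule compact_positive_semigroup.intro)
    fix t :: real assume t: "0 \<le> t"
    then show "bounded_linear (?R t)" by (rule R_lin)
    show "norm (?R t x) \<le> M * norm x" for x using M(2) t by simp
    fix s x assume s: "(0::real) \<le> s"
    have "T (s + t) = T s \<circ> T t" using C0 s t unfolding C0_semigroup_def by blast
    then show "?R (s + t) x = ?R s (?R t x)"
      using re[OF s, of "T t (of_real_part x)"] by (simp add: real_restriction_def)
  next
    show "?R 0 x = x" for x
      using C0 unfolding C0_semigroup_def real_restriction_def by simp
    show "0 \<le> ?R t x" if "t0 \<le> t" "0 \<le> x" for t x
    proof -
      have "0 \<le> of_real_part x" using that by (simp add: less_eq_complexification_def)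
      from t0(2)[OF that(1) this] show ?thesis
        by (simp add: less_eq_complexification_def real_restriction_def)
    qed
  next
    fix \<tau> :: "nat \<Rightarrow> real" and x assume \<tau>: "\<And>n. 0 \<le> \<tau> n"
    have "seq_compact (closure ((\<lambda>t. T t (of_real_part x)) ` {0..}))"
      using cpt compact_imp_seq_compact unfolding relatively_compact_orbits_def by blast
    moreover have "\<forall>n. T (\<tau> n) (of_real_part x) \<in> closure ((\<lambda>t. T t (of_real_part x)) ` {0..})"
      using \<tau> by (intro allI subsetD[OF closure_subset]) auto
    ultimately obtain l r where "strict_mono (r :: nat \<Rightarrow> nat)"
        "((\<lambda>n. T (\<tau> n) (of_real_part x)) \<circ> r) \<longlonglongrightarrow> l"
      by (rule seq_compactE)
    then show "\<exists>l r. strict_mono (r :: nat \<Rightarrow> nat) \<and> (\<lambda>n. ?R (\<tau> (r n)) x) \<longlonglongrightarrow> l"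
      using bounded_linear.tendsto[OF bounded_linear_re_part] unfolding real_restriction_def o_def by blast
  next
    fix e :: real assume "0 < e"
    then obtain \<tau> where \<tau>: "0 < \<tau>" "\<forall>t\<in>{0..\<tau>}. \<forall>f. norm (T (1 + t) f - T 1 f) \<le> e * norm f"
      using analytic_increment_bound[OF analytic op] by blast
    have "norm (?R (1 + t) x - ?R 1 x) \<le> e * norm x" if "t \<in> {0..\<tau>}" for t x
      using norm_re_part_le[of "T (1 + t) (of_real_part x) - T 1 (of_real_part x)"]
        \<tau>(2)[rule_format, OF that, of "of_real_part x"]
      by (simp add: real_restriction_def)
    with \<tau>(1) show "\<exists>\<tau>>0. \<forall>t\<in>{0..\<tau>}. \<forall>x. norm (?R (1 + t) x - ?R 1 x) \<le> e * norm x" by blast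
  next
    fix J :: "'a set"
    assume sub: "subspace J" and clo: "closed J"
      and ideal: "\<And>x y. x \<in> J \<Longrightarrow> \<bar>y\<bar> \<le> \<bar>x\<bar> \<Longrightarrow> y \<in> J"
      and inv: "\<And>t x. t0 \<le> t \<Longrightarrow> x \<in> J \<Longrightarrow> ?R t x \<in> J"
    define I where "I = re_part -` J \<inter> im_part -` J"
    have "lattice_ideal I"
      unfolding lattice_ideal_def
    proof (intro conjI allI impI)
      show "csubspace I"
        using sub unfolding csubspace_def I_def
        by (auto simp: scaleC_def subspace_0 intro!: subspace_add subspace_diff subspace_scale)
      fix x y assume xy: "\<bar>y\<bar> \<le> \<bar>x\<bar> \<and> x \<in> I"
      then have x: "x \<in> I" by blast
      have yx: "modulus y \<le> modulus x"
        using xy by (simp add: abs_complexification_def less_eq_complexification_def)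
      \<comment> \<open>This element of \<open>J\<close> dominates the modulus of \<open>x\<close>,
        hence that of \<open>y\<close>, which in turn dominates both parts of
        \<open>y\<close>.\<close>
      have "\<bar>re_part x\<bar> + \<bar>im_part x\<bar> \<in> J"
        using x ideal[of "re_part x" "\<bar>re_part x\<bar>"] ideal[of "im_part x" "\<bar>im_part x\<bar>"]
        unfolding I_def by (intro subspace_add[OF sub]) simp_all
      moreover have "modulus y \<le> \<bar>\<bar>re_part x\<bar> + \<bar>im_part x\<bar>\<bar>"
        using order_trans[OF yx modulus_le[of x]] by simp
      ultimately show "y \<in> I"
        unfolding I_def
        using ideal order_trans[OF abs_re_le_modulus] order_trans[OF abs_im_le_modulus] by blast
    qed
    moreover have "closed I"
      unfolding I_def
      by (intro closed_Int closed_vimage clo linear_continuous_on bounded_linear_re_part bounded_linear_im_part)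
    moreover have "\<exists>t0\<ge>0. \<forall>t\<ge>t0. T t ` I \<subseteq> I"
    proof (intro exI[of _ t0] conjI allI impI t0(1))
      fix t assume "t0 \<le> t"
      then show "T t ` I \<subseteq> I" using t0(1) inv unfolding I_def by (auto simp: re im)
    qed
    ultimately have I: "I = {0} \<or> I = UNIV"
      using irr unfolding persistently_irreducible_def by blast
    have J_iff: "x \<in> J \<longleftrightarrow> of_real_part x \<in> I" for x
      using sub by (simp add: I_def subspace_0)
    have "of_real_part x = 0 \<longleftrightarrow> x = 0" for x :: 'a by (simp add: complexification_eq_iff)
    with I J_iff show "J = {0} \<or> J = UNIV" by auto
  qed (use M(1) t0(1) in auto)
  then show thesis by (rule that)
qed

theorem theorem6p4:
  fixes T :: "real \<Rightarrow> 'a :: banach_lattice complexification \<Rightarrow> 'a complexification"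
  assumes "C0_semigroup T"
    and "real_semigroup T"
    and "analytic_semigroup T"
    and "uniformly_eventually_positive T"
    and "persistently_irreducible T"
    and "relatively_compact_orbits T"
  shows "converges_strongly T (\<lambda>f. 0) \<longleftrightarrow>
    \<not> (\<exists>u \<phi>. quasi_interior_point u \<and> \<phi> \<in> dual_space \<and> strictly_positive \<phi> \<and>
      rank_one_projection (u \<otimes>\<^sub>o \<phi>) \<and> converges_strongly T (u \<otimes>\<^sub>o \<phi>) \<and>
      (u, 0) \<in> generator T \<and> (\<phi>, \<lambda>f. 0) \<in> dual_operator (generator T))"
proof
  assume zero: "converges_strongly T (\<lambda>f. 0)"
  \<comment> \<open>Strong limits are unique and a projection of rank one is nonzero, so the two
    alternatives exclude each other.\<close>
  have False if proj: "rank_one_projection P" and lim: "converges_strongly T P" for P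
  proof -
    have P: "P f = 0" for f
      using zero lim tendsto_unique[of at_top "\<lambda>t. T t f" "P f" 0] unfolding converges_strongly_def by simp
    obtain v where v: "v \<noteq> 0" "range P = range (\<lambda>c. c *\<^sub>C v)"
      using proj unfolding rank_one_projection_def by blast
    have "1 *\<^sub>C v \<in> range P" unfolding v(2) by blast
    then have "v = 0" using P scaleC_of_real[of 1 v] by auto
    with v(1) show False by blast
  qed
  then show "\<not> (\<exists>u \<phi>. quasi_interior_point u \<and> \<phi> \<in> dual_space \<and> strictly_positive \<phi> \<and>
      rank_one_projection (u \<otimes>\<^sub>o \<phi>) \<and> converges_strongly T (u \<otimes>\<^sub>o \<phi>) \<and>
      (u, 0) \<in> generator T \<and> (\<phi>, \<lambda>f. 0) \<in> dual_operator (generator T))" by blast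
next
  assume none: "\<not> (\<exists>u \<phi>. quasi_interior_point u \<and> \<phi> \<in> dual_space \<and> strictly_positive \<phi> \<and>
      rank_one_projection (u \<otimes>\<^sub>o \<phi>) \<and> converges_strongly T (u \<otimes>\<^sub>o \<phi>) \<and>
      (u, 0) \<in> generator T \<and> (\<phi>, \<lambda>f. 0) \<in> dual_operator (generator T))"
  let ?R = "real_restriction T"
  have op: "bounded_operator (T t)" if "0 \<le> t" for t using assms(1) that by (simp add: C0_semigroup_def)
  have ro: "real_operator (T t)" if "0 \<le> t" for t using assms(2) that by (simp add: real_semigroup_def)
  have re: "re_part (T t f) = ?R t (re_part f)" and im: "im_part (T t f) = ?R t (im_part f)" if "0 \<le> t" for t f
    unfolding real_restriction_def
    by (rule real_operator_parts[OF op[OF that] ro[OF that]])+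
  have lift: "((\<lambda>t. T t f) \<longlongrightarrow> l) at_top"
    if "((\<lambda>t. ?R t (re_part f)) \<longlongrightarrow> re_part l) at_top" "((\<lambda>t. ?R t (im_part f)) \<longlongrightarrow> im_part l) at_top" for f l
  proof (rule tendsto_complexification)
    have ev: "\<forall>\<^sub>F t in at_top. (0::real) \<le> t" by (rule eventually_ge_at_top)
    show "((\<lambda>t. re_part (T t f)) \<longlongrightarrow> re_part l) at_top"
      by (rule Lim_transform_eventually[OF that(1)]) (use ev in eventually_elim, simp add: re)
    show "((\<lambda>t. im_part (T t f)) \<longlongrightarrow> im_part l) at_top"
      by (rule Lim_transform_eventually[OF that(2)]) (use ev in eventually_elim, simp add: im)
  qed
  obtain t0 M where sg: "compact_positive_semigroup ?R t0 M"
    by (rule real_restriction_locale[OF assms])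
  show "converges_strongly T (\<lambda>f. 0)"
  proof (rule ccontr)
    assume "\<not> converges_strongly T (\<lambda>f. 0)"
    then have "\<exists>x. \<not> ((\<lambda>t. ?R t x) \<longlongrightarrow> 0) at_top"
      using lift[of _ 0] unfolding converges_strongly_def by auto
    then interpret nonvanishing_positive_semigroup ?R t0 M
      using sg by (simp add: nonvanishing_positive_semigroup_def nonvanishing_positive_semigroup_axioms_def)
    obtain u \<phi> where u: "0 \<le> u" "u \<noteq> 0" "\<And>t. 0 \<le> t \<Longrightarrow> ?R t u = u"
      and lim: "\<And>x. ((\<lambda>t. ?R t x) \<longlongrightarrow> \<phi> x *\<^sub>R u) at_top"
      and pos: "\<And>x. 0 \<le> x \<Longrightarrow> x \<noteq> 0 \<Longrightarrow> 0 < \<phi> x"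
      and lin: "bounded_linear \<phi>" and \<phi>u: "\<phi> u = 1" and inv: "\<And>t x. 0 \<le> t \<Longrightarrow> \<phi> (?R t x) = \<phi> x"
      by (rule rank_one_limit) blast
    interpret \<phi>: bounded_linear \<phi> by (rule lin)
    define U where "U = of_real_part u"
    \<comment> \<open>The complex-linear extension of \<open>\<phi>\<close>.\<close>
    define \<Phi> where "\<Phi> f = Complex (\<phi> (re_part f)) (\<phi> (im_part f))" for f
    have U: "U \<noteq> 0" "0 \<le> U" using u by (auto simp: U_def complexification_eq_iff less_eq_complexification_def)
    have \<Phi>_add: "\<Phi> (f + g) = \<Phi> f + \<Phi> g" for f g by (simp add: \<Phi>_def \<phi>.add complex_eq_iff)
    have \<Phi>_scaleC: "\<Phi> (c *\<^sub>C f) = c * \<Phi> f" for c f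
      by (simp add: \<Phi>_def scaleC_def \<phi>.add \<phi>.diff \<phi>.scaleR complex_eq_iff)
    have \<Phi>_scaleR: "\<Phi> (r *\<^sub>R f) = r *\<^sub>R \<Phi> f" for r f by (simp add: \<Phi>_def \<phi>.scaleR complex_eq_iff)
    obtain K where K: "0 \<le> K" "\<And>x. norm (\<phi> x) \<le> norm x * K" using \<phi>.nonneg_bounded by blast
    have \<Phi>_lin: "bounded_linear \<Phi>"
    proof (rule bounded_linear_intro[OF \<Phi>_add \<Phi>_scaleR])
      fix f
      have "norm (\<Phi> f) \<le> norm (\<phi> (re_part f)) + norm (\<phi> (im_part f))"
        using cmod_le[of "\<Phi> f"] by (simp add: \<Phi>_def)
      also have "\<dots> \<le> norm (re_part f) * K + norm (im_part f) * K" by (intro add_mono K)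
      also have "\<dots> \<le> norm f * K + norm f * K"
        by (intro add_mono mult_right_mono norm_re_part_le norm_im_part_le K)
      finally show "norm (\<Phi> f) \<le> norm f * (2 * K)" by (simp add: mult.left_commute mult.commute)
    qed
    have \<Phi>_inv: "\<Phi> (T t f) = \<Phi> f" if "0 \<le> t" for t f
      using that by (simp add: \<Phi>_def re im inv)
    have \<Phi>U: "\<Phi> U = 1" by (simp add: \<Phi>_def U_def \<phi>u \<phi>.zero complex_eq_iff)
    have dual: "\<Phi> \<in> dual_space" using \<Phi>_lin \<Phi>_scaleC by (simp add: dual_space_def)
    have quasi: "quasi_interior_point U"
      unfolding quasi_interior_point_def
    proof (intro conjI U(2) equalityI subset_UNIV subsetI)
      fix f
      show "f \<in> closure (principal_ideal U)"
        unfolding closure_approachable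
      proof (intro allI impI)
        fix e :: real assume "0 < e"
        then have e: "0 < e / 2" by simp
        obtain x c where x: "0 < c" "\<bar>x\<bar> \<le> c *\<^sub>R u" "norm (re_part f - x) < e / 2"
          using fixed_vector_ideal_dense[OF u(1,2,3) e] by blast
        obtain y d where y: "0 < d" "\<bar>y\<bar> \<le> d *\<^sub>R u" "norm (im_part f - y) < e / 2"
          using fixed_vector_ideal_dense[OF u(1,2,3) e] by blast
        have "modulus (Complexification x y) \<le> (c + d) *\<^sub>R u"
          using order_trans[OF modulus_le[of "Complexification x y"], simplified, OF add_mono[OF x(2) y(2)]]
          by (simp add: scaleR_left_distrib)
        then have "Complexification x y \<in> principal_ideal U"
          using x(1) y(1) unfolding principal_ideal_def U_def
          by (auto simp: abs_complexification_def less_eq_complexification_def intro!: exI[of _ "c + d"])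
        moreover have "dist (Complexification x y) f < e"
          using norm_complexification_le[of "Complexification x y - f"] x(3) y(3)
          by (simp add: dist_norm norm_minus_commute)
        ultimately show "\<exists>y\<in>principal_ideal U. dist y f < e" by blast
      qed
    qed
    have strict: "strictly_positive \<Phi>"
    proof -
      have "0 < \<Phi> f" if "0 \<le> f" "f \<noteq> 0" for f
        using that pos[of "re_part f"]
        by (auto simp: \<Phi>_def less_eq_complexification_def complexification_eq_iff less_complex_def \<phi>.zero)
      moreover have "\<Phi> 0 = 0" by (simp add: \<Phi>_def \<phi>.zero complex_eq_iff)
      ultimately show ?thesis unfolding strictly_positive_def by (metis order.refl less_imp_le)
    qed
    have conv: "converges_strongly T (U \<otimes>\<^sub>o \<Phi>)"
      unfolding converges_strongly_def rank_one_op_def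
      using lim by (intro allI lift) (simp_all add: U_def \<Phi>_def scaleC_def)
    have proj: "rank_one_projection (U \<otimes>\<^sub>o \<Phi>)"
      unfolding rank_one_projection_def
    proof (intro conjI exI[of _ U] U(1))
      have "bounded_linear (U \<otimes>\<^sub>o \<Phi>)"
      proof (rule bounded_linear_intro)
        show "norm ((U \<otimes>\<^sub>o \<Phi>) f) \<le> norm f * (onorm \<Phi> * norm U)" for f
          using mult_right_mono[OF onorm[OF \<Phi>_lin, of f] norm_ge_zero[of U]]
          by (simp add: rank_one_op_def mult.assoc mult.left_commute)
      qed (simp_all add: rank_one_op_def \<Phi>_add \<Phi>_scaleR scaleC_def complexification_eq_iff algebra_simps)
      then show "bounded_operator (U \<otimes>\<^sub>o \<Phi>)"
        unfolding bounded_operator_def by (simp add: rank_one_op_def \<Phi>_scaleC scaleC_scaleC)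
      show "(U \<otimes>\<^sub>o \<Phi>) \<circ> (U \<otimes>\<^sub>o \<Phi>) = U \<otimes>\<^sub>o \<Phi>"
        by (simp add: rank_one_op_def fun_eq_iff \<Phi>_scaleC \<Phi>U)
      have "c *\<^sub>C U = (U \<otimes>\<^sub>o \<Phi>) (c *\<^sub>C U)" for c by (simp add: rank_one_op_def \<Phi>_scaleC \<Phi>U)
      then show "range (U \<otimes>\<^sub>o \<Phi>) = range (\<lambda>c. c *\<^sub>C U)" by (auto simp: rank_one_op_def)
    qed
    have right: "\<forall>\<^sub>F h in at_right 0. (0::real) < h" by (rule eventually_at_right_less)
    have gen: "(U, 0) \<in> generator T"
      unfolding generator_def mem_Collect_eq case_prod_conv
    proof (rule tendsto_eventually)
      show "\<forall>\<^sub>F h in at_right 0. inverse h *\<^sub>R (T h U - U) = 0"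
        using right
        by eventually_elim (simp add: complexification_eq_iff re im U_def u(3) zero)
    qed
    \<comment> \<open>Invariance makes \<open>\<Phi>\<close> vanish on every difference quotient,
      hence on its limit.\<close>
    have "\<Phi> g = 0" if "(f, g) \<in> generator T" for f g
    proof -
      have "((\<lambda>h. \<Phi> (inverse h *\<^sub>R (T h f - f))) \<longlongrightarrow> \<Phi> g) (at_right 0)"
        using that unfolding generator_def by (intro bounded_linear.tendsto[OF \<Phi>_lin]) simp
      moreover have "\<forall>\<^sub>F h in at_right 0. \<Phi> (inverse h *\<^sub>R (T h f - f)) = 0"
        using right by eventually_elim (simp add: \<Phi>_scaleR linear_simps(2)[OF \<Phi>_lin] \<Phi>_inv)
      then have "((\<lambda>h. \<Phi> (inverse h *\<^sub>R (T h f - f))) \<longlongrightarrow> 0) (at_right 0)"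
        by (rule tendsto_eventually)
      ultimately show ?thesis by (intro tendsto_unique[of "at_right (0::real)"]) simp_all
    qed
    moreover have "(\<lambda>f. 0) \<in> dual_space" by (simp add: dual_space_def)
    ultimately have "(\<Phi>, \<lambda>f. 0) \<in> dual_operator (generator T)"
      using dual by (auto simp: dual_operator_def)
    then show False using none quasi dual strict proj conv gen by blast
  qed
qed

end
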